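(* Let $\mu,\nu\in\mathbb{R}$ and let $f\in C_b^1([0,\infty))$ with $\lim_{x\to\infty}f(x)=0$. Let $u$ be the unique function with $u\in C^\infty((0,\infty)\times[0,\infty))$, $u,u_x\in C_b([0,T]\times[0,\infty))$ for every $T>0$, $\lim_{x\to\infty}u(t,x)=0$ for every $t>0$, solving \[ u_t=\mu u_x+\tfrac12 u_{xx}\ (t>0,\ x\ge0),\qquad u(0,x)=f(x)\ (x\ge0),\qquad u_t(t,0)=\nu u_x(t,0)\ (t>0). \] Then for all $t\ge 0$ and $x\ge 0$, \[ u(t,x)=\mathbb{E}_x\big[f(X_t)\big]-\mathbb{E}_x\Big[f'(X_t)\int_0^{\ell_t^0(X)}e^{-2(\nu-\mu)s}\,ds\Big], \] where $X$ is a reflecting Brownian motion with drift $\mu$ started at $x$ under $\mathbb{P}_x$ and $\ell^0(X)$ is its local time at $0$.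
   Context: $C_b^1([0,\infty))$ denotes the set of $C^1$ functions $f$ on $[0,\infty)$ with $f,f'$ bounded; $C_b(A)$ denotes bounded continuous functions on $A$. A reflecting Brownian motion $X$ with drift $\mu$ started at $x\ge0$, together with its local time $\ell^0(X)$ at $0$, is the pair of continuous processes with $X_t\ge 0$, $X_t=x+W_t+\mu t+\ell^0_t(X)$ for a standard Brownian motion $W$, where $\ell^0(X)$ is nondecreasing, $\ell^0_0(X)=0$, and increases only on $\{t: X_t=0\}$. Equivalently, with $B$ a standard Brownian motion, $B^{-\mu}_t=B_t-\mu t$ and $S^{-\mu}_t=\sup_{0\le s\le t}B^{-\mu}_s$, one may take $X_t=x\vee S^{-\mu}_t-B^{-\mu}_t$ and $\ell^0_t(X)=x\vee S^{-\mu}_t-x$. *)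

theory Defs
  imports "HOL-Probability.Probability"
begin

definition std_brownian_motion :: "'a measure \<Rightarrow> (real \<Rightarrow> 'a \<Rightarrow> real) \<Rightarrow> bool" where
  "std_brownian_motion M B \<longleftrightarrow>
     prob_space M \<and>
     (\<forall>t\<ge>0. B t \<in> borel_measurable M) \<and>
     (\<forall>\<omega>\<in>space M. B 0 \<omega> = 0) \<and>
     (\<forall>\<omega>\<in>space M. continuous_on {0..} (\<lambda>t. B t \<omega>)) \<and>
     (\<forall>(n::nat) (ts::nat \<Rightarrow> real). 0 \<le> ts 0 \<and> (\<forall>i<n. ts i < ts (Suc i)) \<longrightarrow>
        prob_space.indep_vars M (\<lambda>_. borel) (\<lambda>i \<omega>. B (ts (Suc i)) \<omega> - B (ts i) \<omega>) {..<n}) \<and>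
     (\<forall>s t. 0 \<le> s \<and> s < t \<longrightarrow>
        distributed M lborel (\<lambda>\<omega>. B t \<omega> - B s \<omega>) (\<lambda>y. ennreal (normal_density 0 (sqrt (t - s)) y)))"

definition run_sup :: "real \<Rightarrow> (real \<Rightarrow> 'a \<Rightarrow> real) \<Rightarrow> real \<Rightarrow> 'a \<Rightarrow> real" where
  "run_sup \<mu> B t \<omega> = (SUP s\<in>{0..t}. B s \<omega> - \<mu> * s)"

definition refl_bm :: "real \<Rightarrow> real \<Rightarrow> (real \<Rightarrow> 'a \<Rightarrow> real) \<Rightarrow> real \<Rightarrow> 'a \<Rightarrow> real" where
  "refl_bm \<mu> x B t \<omega> = max x (run_sup \<mu> B t \<omega>) - (B t \<omega> - \<mu> * t)"

definition refl_local_time :: "real \<Rightarrow> real \<Rightarrow> (real \<Rightarrow> 'a \<Rightarrow> real) \<Rightarrow> real \<Rightarrow> 'a \<Rightarrow> real" where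
  "refl_local_time \<mu> x B t \<omega> = max x (run_sup \<mu> B t \<omega>) - x"

text \<open>C-infinity on a set S of the (t,x)-plane (up to the boundary): g lies in a family F
  of functions, each continuous on S and whose partial derivatives in t and in x
  (taken within the slices of S) exist at every point of S and again lie in F.
  Equivalently: all iterated partial derivatives exist and are continuous on S.\<close>
definition C_inf_on :: "(real \<times> real) set \<Rightarrow> (real \<times> real \<Rightarrow> real) \<Rightarrow> bool" where
  "C_inf_on S g \<longleftrightarrow> (\<exists>F. g \<in> F \<and> (\<forall>h\<in>F. continuous_on S h \<and>
     (\<exists>h1\<in>F. \<exists>h2\<in>F. \<forall>p\<in>S.
        ((\<lambda>s. h (s, snd p)) has_real_derivative h1 p) (at (fst p) within {s. (s, snd p) \<in> S}) \<and>
        ((\<lambda>y. h (fst p, y)) has_real_derivative h2 p) (at (snd p) within {y. (fst p, y) \<in> S}))))"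

end

theory Submission
  imports Defs
begin

text \<open>The derivative \<open>v = u\<^sub>x\<close> solves the same equation with the Robin condition \<open>v\<^sub>x = c v\<close> at \<open>0\<close>,
  \<open>c = 2 (\<nu> - \<mu>)\<close>, and therefore \<open>v(t,y) = E[f'(X\<^sub>t) exp (- c l\<^sub>t)]\<close> for the process started at \<open>y\<close> with
  local time \<open>l\<close>. Stochastic calculus is avoided: the running supremum is replaced by the maximum over
  a grid of mesh \<open>h\<close>, which turns the pair \<open>(X, l)\<close> into a Markov chain with Gaussian increments. One step
  of this chain reproduces \<open>v\<close> up to \<open>o(h)\<close> and a boundary error that is quadratic in the increment of the
  local time; a discrete maximum principle sums these errors, and \<open>h \<rightarrow> 0\<close> is a dominated convergence.
  Finally the starting point \<open>y\<close> is integrated from \<open>x\<close> to \<open>\<infinity>\<close>: pathwise, \<open>f'(X\<^sub>t) exp (- c l\<^sub>t)\<close> is the derivative in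
  \<open>y\<close> of the functional whose expectation is sought.\<close>

subsection \<open>Gaussian increments\<close>

text \<open>The Robin condition is the boundary condition with u_t eliminated: at x = 0 the equation
  gives \<nu> u_x = \<mu> u_x + u_xx / 2. The obstacle is the boundary. From positions within about
  sqrt h of 0, one step of the chain can miss \<open>v\<close> by order h instead of o(h), and a
  bound uniform in the position would not vanish after summing about 1 / h steps. The error is
  therefore charged to the overshoot below 0: it is at most \<delta> h plus \<delta> times the
  expected overshoot, and overshoots along a path add up to the local time. \<open>barrier\<close>
  makes this precise without computing any law: one step multiplies it by at most
  \<open>exp (barrier_rate c \<mu> * h)\<close> and then subtracts the expected overshoot. Its
  parameter has two uses: \<open>a = 0\<close> gives a bounded barrier, hence bounds on the iterates
  uniform in the mesh, and \<open>a = 1\<close> gives growth at infinity, where no uniform bounds on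
  the derivatives of \<open>v\<close> are available. Near t = 0 the derivatives beyond u_x are
  uncontrolled as well, so the comparison starts at a time \<epsilon> > 0; the passage \<epsilon> ->
  0 then uses only continuity and boundedness of u_x.\<close>

definition gauss :: "real \<Rightarrow> real measure" where
  "gauss h = density lborel (\<lambda>s. ennreal (normal_density 0 (sqrt h) s))"

lemma sets_gauss [measurable_cong, simp]: "sets (gauss h) = sets borel"
  by (simp add: gauss_def)

lemma space_gauss [simp]: "space (gauss h) = UNIV"
  by (simp add: gauss_def)

lemma prob_space_gauss: "h > 0 \<Longrightarrow> prob_space (gauss h)"
  unfolding gauss_def by (rule prob_space_normal_density) simp

lemma has_bochner_integral_gauss_exp:
  assumes "h > 0"
  shows "has_bochner_integral (gauss h) (\<lambda>s. exp (a * s)) (exp (a\<^sup>2 * h / 2))"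
proof -
  have eq: "normal_density 0 (sqrt h) s * exp (a * s) = exp (a\<^sup>2 * h / 2) * normal_density (a * h) (sqrt h) s" for s
  proof -
    have "- (s\<^sup>2) / (2 * h) + a * s = a\<^sup>2 * h / 2 + - ((s - a * h)\<^sup>2) / (2 * h)"
      using assms by (simp add: field_simps power2_eq_square)
    then have "exp (- (s\<^sup>2) / (2 * h)) * exp (a * s) = exp (a\<^sup>2 * h / 2) * exp (- ((s - a * h)\<^sup>2) / (2 * h))"
      by (simp add: exp_add [symmetric])
    then show ?thesis
      using assms by (simp add: normal_density_def)
  qed
  have "has_bochner_integral lborel (\<lambda>s. exp (a\<^sup>2 * h / 2) * normal_density (a * h) (sqrt h) s) (exp (a\<^sup>2 * h / 2) * 1)"
    by (intro has_bochner_integral_mult_right)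
       (use assms in \<open>simp add: has_bochner_integral_iff\<close>)
  then show ?thesis
    unfolding gauss_def
    by (intro has_bochner_integral_density) (auto simp: eq)
qed

lemma gauss_moments:
  assumes "h > 0"
  shows "has_bochner_integral (gauss h) (\<lambda>s. s) 0"
    and "has_bochner_integral (gauss h) (\<lambda>s. s\<^sup>2) h"
proof -
  have p: "0 < sqrt h" using assms by simp
  show "has_bochner_integral (gauss h) (\<lambda>s. s) 0"
    unfolding gauss_def
    using normal_moment_odd[OF p, of 0 0]
    by (intro has_bochner_integral_density) auto
  show "has_bochner_integral (gauss h) (\<lambda>s. s\<^sup>2) h"
    unfolding gauss_def
    using normal_moment_even[OF p, of 0 1] assms
    by (intro has_bochner_integral_density) (auto simp: fact_numeral power2_eq_square)
qed

lemma gauss_exp_abs: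
  assumes h: "h > 0"
  shows "integrable (gauss h) (\<lambda>s. exp (a * \<bar>s\<bar>))"
    and "(\<integral>s. exp (a * \<bar>s\<bar>) \<partial>gauss h) \<le> 2 * exp (a\<^sup>2 * h / 2)"
proof -
  have le: "exp (a * \<bar>s\<bar>) \<le> exp (a * s) + exp (- a * s)" for s
    by (cases "s \<ge> 0") auto
  note e1 = has_bochner_integral_gauss_exp[OF h, of a] and e2 = has_bochner_integral_gauss_exp[OF h, of "-a"]
  note e = has_bochner_integral_add[OF e1 e2]
  show i: "integrable (gauss h) (\<lambda>s. exp (a * \<bar>s\<bar>))"
    by (rule Bochner_Integration.integrable_bound[OF has_bochner_integral_iff[THEN iffD1, THEN conjunct1, OF e]])
       (use le in \<open>auto intro!: AE_I2 order_trans[OF le]\<close>)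
  have "(\<integral>s. exp (a * \<bar>s\<bar>) \<partial>gauss h) \<le> (\<integral>s. exp (a * s) + exp (- a * s) \<partial>gauss h)"
    using e i by (intro integral_mono) (auto simp: has_bochner_integral_iff intro: le[simplified])
  also have "\<dots> = 2 * exp (a\<^sup>2 * h / 2)"
    using e by (simp add: has_bochner_integral_iff)
  finally show "(\<integral>s. exp (a * \<bar>s\<bar>) \<partial>gauss h) \<le> 2 * exp (a\<^sup>2 * h / 2)" .
qed

text \<open>With \<open>\<bar>s - \<mu> h\<bar> \<le> \<surd>h (\<bar>s\<bar> / \<surd>h + \<bar>\<mu>\<bar>)\<close> and \<open>x\<^sup>3 \<le> 27 e\<^sup>x\<close> only exponential moments are needed.\<close>

lemma gauss_cube_exp:
  fixes \<mu> a h :: real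
  assumes h: "0 < h" "h \<le> 1" and a: "a \<ge> 0"
  defines "D \<equiv> 54 * exp ((1 + a) * \<bar>\<mu>\<bar> + (1 + a)\<^sup>2 / 2)"
  shows "integrable (gauss h) (\<lambda>s. \<bar>s - \<mu> * h\<bar> ^ 3 * exp (a * \<bar>s - \<mu> * h\<bar>))"
    and "(\<integral>s. \<bar>s - \<mu> * h\<bar> ^ 3 * exp (a * \<bar>s - \<mu> * h\<bar>) \<partial>gauss h) \<le> D * (h * sqrt h)"
proof -
  define r where "r = sqrt h"
  have r: "0 < r" "r \<le> 1" "r * r = h" using h by (auto simp: r_def)
  \<comment> \<open>The exponent scales like 1 / sqrt h, which makes the Gaussian moment
    \<open>exp (b\<^sup>2 * h / 2)\<close> independent of \<open>h\<close>; all smallness sits in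
    the factor \<open>h * r\<close>. The 54 in \<open>D\<close> is 27 from the cube bound times 2
    from \<open>gauss_exp_abs\<close>.\<close>
  define b where "b = (1 + a) / r"
  have cube: "x ^ 3 \<le> 27 * exp x" if "x \<ge> 0" for x :: real
  proof -
    have "(x / 3) ^ 3 \<le> exp (x / 3) ^ 3"
      using exp_ge_add_one_self[of "x / 3"] that by (intro power_mono) linarith+
    also have "\<dots> = exp x" by (simp add: exp_of_nat_mult[symmetric])
    finally show ?thesis by (simp add: power_divide)
  qed
  have le: "\<bar>s - \<mu> * h\<bar> ^ 3 * exp (a * \<bar>s - \<mu> * h\<bar>) \<le> 27 * (h * r) * exp ((1 + a) * \<bar>\<mu>\<bar>) * exp (b * \<bar>s\<bar>)" for s
  proof -
    define x where "x = \<bar>s - \<mu> * h\<bar> / r"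
    have x0: "x \<ge> 0" using r by (simp add: x_def)
    have e: "\<bar>s - \<mu> * h\<bar> = r * x" using r by (simp add: x_def)
    have "\<bar>s - \<mu> * h\<bar> \<le> \<bar>s\<bar> + \<bar>\<mu>\<bar> * h" using h by (metis abs_mult abs_of_pos abs_triangle_ineq4)
    also have "\<dots> \<le> \<bar>s\<bar> + \<bar>\<mu>\<bar> * r"
    proof -
      have "h \<le> r" using r by (metis less_imp_le mult_left_le)
      then show ?thesis by (simp add: mult_left_mono)
    qed
    finally have xle: "x \<le> \<bar>s\<bar> / r + \<bar>\<mu>\<bar>" using r by (simp add: x_def field_simps)
    have "a * (r * x) \<le> a * x" using a x0 r by (intro mult_left_mono) (auto intro: mult_left_le_one_le)
    then have "(r * x) ^ 3 * exp (a * (r * x)) \<le> (r ^ 3 * (27 * exp x)) * exp (a * x)"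
      using cube[OF x0] r x0 by (intro mult_mono) (auto simp: power_mult_distrib)
    also have "\<dots> = 27 * (h * r) * exp ((1 + a) * x)"
      using r by (simp add: exp_add[symmetric] algebra_simps power3_eq_cube)
    also have "\<dots> \<le> 27 * (h * r) * exp ((1 + a) * (\<bar>s\<bar> / r + \<bar>\<mu>\<bar>))"
      using xle a h r by (intro mult_left_mono) auto
    also have "\<dots> = 27 * (h * r) * exp ((1 + a) * \<bar>\<mu>\<bar>) * exp (b * \<bar>s\<bar>)"
      by (simp add: b_def exp_add[symmetric] algebra_simps add_divide_distrib)
    finally show ?thesis unfolding e .
  qed
  have i2: "integrable (gauss h) (\<lambda>s. 27 * (h * r) * exp ((1 + a) * \<bar>\<mu>\<bar>) * exp (b * \<bar>s\<bar>))"
    using gauss_exp_abs(1)[OF h(1)] by simp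
  show i: "integrable (gauss h) (\<lambda>s. \<bar>s - \<mu> * h\<bar> ^ 3 * exp (a * \<bar>s - \<mu> * h\<bar>))"
    by (rule Bochner_Integration.integrable_bound[OF i2]) (use le h r in \<open>auto intro!: AE_I2 simp: abs_mult\<close>)
  have "(\<integral>s. \<bar>s - \<mu> * h\<bar> ^ 3 * exp (a * \<bar>s - \<mu> * h\<bar>) \<partial>gauss h)
      \<le> (\<integral>s. 27 * (h * r) * exp ((1 + a) * \<bar>\<mu>\<bar>) * exp (b * \<bar>s\<bar>) \<partial>gauss h)"
    by (rule integral_mono[OF i i2 le])
  also have "\<dots> = 27 * (h * r) * exp ((1 + a) * \<bar>\<mu>\<bar>) * (\<integral>s. exp (b * \<bar>s\<bar>) \<partial>gauss h)"
    by simp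
  also have "\<dots> \<le> 27 * (h * r) * exp ((1 + a) * \<bar>\<mu>\<bar>) * (2 * exp (b\<^sup>2 * h / 2))"
    using gauss_exp_abs(2)[OF h(1), of b] h r by (intro mult_left_mono) auto
  also have "b\<^sup>2 * h = (1 + a)\<^sup>2"
    using r h by (simp add: b_def power_divide power2_eq_square[of r])
  finally show "(\<integral>s. \<bar>s - \<mu> * h\<bar> ^ 3 * exp (a * \<bar>s - \<mu> * h\<bar>) \<partial>gauss h) \<le> D * (h * sqrt h)"
    by (simp add: D_def r_def exp_add algebra_simps)
qed

subsection \<open>The discretised reflecting process and its barrier\<close>

text \<open>One step of the discretised process: the Lindley recursion \<open>X \<mapsto> max 0 (X - \<eta>)\<close> with
  \<open>\<eta> = s - \<mu> h\<close> adds \<open>max 0 (\<eta> - X)\<close> to the local time.\<close>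

definition robin_step :: "real \<Rightarrow> real \<Rightarrow> real \<Rightarrow> (real \<Rightarrow> real) \<Rightarrow> real \<Rightarrow> real" where
  "robin_step c \<mu> h g y =
     (\<integral>s. g (max 0 (y - (s - \<mu> * h))) * exp (- c * max 0 (s - \<mu> * h - y)) \<partial>gauss h)"

lemma gauss_exp_drift:
  assumes h: "h > 0"
  shows "integrable (gauss h) (\<lambda>s. exp (a * \<bar>s - \<mu> * h\<bar>))"
proof -
  have le: "exp (a * \<bar>s - \<mu> * h\<bar>) \<le> exp (\<bar>a\<bar> * \<bar>\<mu>\<bar> * h) * exp (\<bar>a\<bar> * \<bar>s\<bar>)" for s
  proof -
    have "a * \<bar>s - \<mu> * h\<bar> \<le> \<bar>a\<bar> * \<bar>s - \<mu> * h\<bar>" by (intro mult_right_mono) auto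
    also have "\<bar>s - \<mu> * h\<bar> \<le> \<bar>s\<bar> + \<bar>\<mu>\<bar> * h" using h by (metis abs_mult abs_of_pos abs_triangle_ineq4)
    finally have "a * \<bar>s - \<mu> * h\<bar> \<le> \<bar>a\<bar> * (\<bar>s\<bar> + \<bar>\<mu>\<bar> * h)" by (simp add: mult_left_mono)
    then show ?thesis by (simp add: exp_add[symmetric] algebra_simps)
  qed
  have i: "integrable (gauss h) (\<lambda>s. exp (\<bar>a\<bar> * \<bar>\<mu>\<bar> * h) * exp (\<bar>a\<bar> * \<bar>s\<bar>))"
    using gauss_exp_abs(1)[OF h] by simp
  show ?thesis
    by (rule Bochner_Integration.integrable_bound[OF i]) (use le in auto)
qed

lemma overshoot_exp_le:
  fixes c y \<eta> :: real
  assumes "y \<ge> 0"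
  shows "exp (- c * max 0 (\<eta> - y)) \<le> exp (\<bar>c\<bar> * \<bar>\<eta>\<bar>)"
proof -
  have "- c * max 0 (\<eta> - y) \<le> \<bar>c\<bar> * max 0 (\<eta> - y)"
    by (intro mult_right_mono) auto
  also have "\<dots> \<le> \<bar>c\<bar> * \<bar>\<eta>\<bar>"
    using assms by (intro mult_left_mono) auto
  finally show ?thesis by simp
qed

lemma robin_step_integrable:
  assumes h: "h > 0" and y: "y \<ge> 0"
    and g: "g \<in> borel_measurable borel" "\<And>z. z \<ge> 0 \<Longrightarrow> \<bar>g z\<bar> \<le> C"
  shows "integrable (gauss h) (\<lambda>s. g (max 0 (y - (s - \<mu> * h))) * exp (- c * max 0 (s - \<mu> * h - y)))"
proof -
  have i: "integrable (gauss h) (\<lambda>s. C * exp (\<bar>c\<bar> * \<bar>s - \<mu> * h\<bar>))"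
    using gauss_exp_drift[OF h] by simp
  have C: "C \<ge> 0" using g(2)[of 0] by linarith
  have [measurable]: "g \<in> borel_measurable borel" by fact
  have "\<bar>g (max 0 (y - (s - \<mu> * h)))\<bar> * exp (- c * max 0 (s - \<mu> * h - y)) \<le> C * exp (\<bar>c\<bar> * \<bar>s - \<mu> * h\<bar>)" for s
    using C y by (intro mult_mono g(2) overshoot_exp_le) auto
  then show ?thesis
    by (intro Bochner_Integration.integrable_bound[OF i] AE_I2) (use C in \<open>simp_all add: abs_mult\<close>)
qed

lemma robin_step_measurable [measurable]:
  assumes h: "h > 0" and [measurable]: "g \<in> borel_measurable borel"
  shows "robin_step c \<mu> h g \<in> borel_measurable borel"
proof -
  interpret prob_space "gauss h" by (rule prob_space_gauss[OF h])
  show ?thesis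
    unfolding robin_step_def by measurable
qed

text \<open>The slope of \<open>exp (- (2 * \<bar>c\<bar> + 1) * y)\<close> at \<open>0\<close> is steeper than that of the Robin extension; the slack
  \<open>z\<close> in \<open>barrier_overshoot\<close> pays for the errors made at the boundary.\<close>

definition barrier :: "real \<Rightarrow> real \<Rightarrow> real \<Rightarrow> real" where
  "barrier c a y = cosh (a * y) + exp (- (2 * \<bar>c\<bar> + 1) * y)"

lemma barrier_ge: "barrier c a y \<ge> cosh (a * y)" "barrier c a y \<ge> 1"
  using cosh_real_ge_1[of "a * y"] by (simp_all add: barrier_def add_increasing2)

text \<open>With e = exp (\<bar>c\<bar> z), the left side is 2 e + z, since the barrier equals 2 at
  0. The right side is at least 1 + e^2 exp z \<ge> 1 + e^2 + z, and 1 + e^2 \<ge> 2 e. The extra 1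
  in the slope \<open>2 * \<bar>c\<bar> + 1\<close> produces the summand z.\<close>

lemma barrier_overshoot:
  assumes "z \<ge> 0"
  shows "barrier c a 0 * exp (\<bar>c\<bar> * z) + z \<le> barrier c a (- z)"
proof -
  let ?e = "exp (\<bar>c\<bar> * z)"
  have e1: "?e \<ge> 1" using assms by simp
  have "?e * ?e * exp z \<ge> ?e * ?e * (1 + z)"
    using exp_ge_add_one_self[of z] by (intro mult_left_mono) auto
  moreover have "?e * ?e * z \<ge> 1 * z"
    using e1 assms mult_mono[OF e1 e1] by (intro mult_right_mono) auto
  moreover have "exp ((2 * \<bar>c\<bar> + 1) * z) = ?e * ?e * exp z"
    by (simp add: exp_add[symmetric] algebra_simps)
  moreover have "(?e - 1) * (?e - 1) \<ge> 0" by simp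
  moreover have "cosh (a * z) \<ge> 1" by (rule cosh_real_ge_1)
  ultimately show ?thesis
    by (simp add: barrier_def algebra_simps)
qed

text \<open>A Gaussian step with drift multiplies the mean of exp (k y) by exp ((k \<mu> + k^2 / 2)
  h). The exponents in \<open>barrier c a\<close> have modulus at most
  \<open>2 * \<bar>c\<bar> + 1\<close> as soon as \<bar>a\<bar> \<le> 1, and the rate bounds k \<mu>
  + k^2 / 2 for all of them.\<close>

definition barrier_rate :: "real \<Rightarrow> real \<Rightarrow> real" where
  "barrier_rate c \<mu> = (2 * \<bar>c\<bar> + 1) * \<bar>\<mu>\<bar> + (2 * \<bar>c\<bar> + 1)\<^sup>2 / 2"

text \<open>The reflected step is compared with the free one. By \<open>barrier_overshoot\<close>,
  the weighted barrier at the reflected position plus the overshoot is at most the barrier formula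
  evaluated at the unreflected, possibly negative, position. That formula is a sum of exponentials,
  so its mean under the free Gaussian step is explicit.\<close>

lemma robin_step_barrier:
  fixes a c \<mu> h y :: real
  assumes h: "h > 0" and y: "y \<ge> 0" and a: "0 \<le> a" "a \<le> 1"
  shows "integrable (gauss h) (\<lambda>s. barrier c a (max 0 (y - (s - \<mu> * h))) * exp (\<bar>c\<bar> * max 0 (s - \<mu> * h - y)))"
    and "integrable (gauss h) (\<lambda>s. max 0 (s - \<mu> * h - y))"
    and "robin_step (- \<bar>c\<bar>) \<mu> h (barrier c a) y
      \<le> exp (barrier_rate c \<mu> * h) * barrier c a y - (\<integral>s. max 0 (s - \<mu> * h - y) \<partial>gauss h)"
proof -
  define b where "b = 2 * \<bar>c\<bar> + 1"
  define K where "K = barrier_rate c \<mu>"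
  have b: "b \<ge> 1" by (simp add: b_def)
  define \<eta> where "\<eta> = (\<lambda>s. s - \<mu> * h)"
  have ex: "has_bochner_integral (gauss h) (\<lambda>s. exp (k * (y - \<eta> s))) (exp (k * y) * exp (k * \<mu> * h + k\<^sup>2 * h / 2))" for k
  proof -
    have "exp (k * (y - \<eta> s)) = exp (k * y + k * \<mu> * h) * exp (- k * s)" for s
      by (simp add: exp_add[symmetric] algebra_simps \<eta>_def)
    moreover have "exp (k * y) * exp (k * \<mu> * h + k\<^sup>2 * h / 2) = exp (k * y + k * \<mu> * h) * exp ((- k)\<^sup>2 * h / 2)"
      by (simp add: exp_add[symmetric] algebra_simps)
    ultimately show ?thesis
      using has_bochner_integral_mult_right[OF has_bochner_integral_gauss_exp[OF h, of "- k"], of "exp (k * y + k * \<mu> * h)"]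
      by simp
  qed
  have exle: "exp (k * \<mu> * h + k\<^sup>2 * h / 2) \<le> exp (K * h)" if "\<bar>k\<bar> \<le> b" for k
  proof -
    have "k * \<mu> \<le> \<bar>k\<bar> * \<bar>\<mu>\<bar>" by (metis abs_ge_self abs_mult)
    also have "\<dots> \<le> b * \<bar>\<mu>\<bar>" using that by (rule mult_right_mono) simp
    finally have "k * \<mu> \<le> b * \<bar>\<mu>\<bar>" .
    moreover have "k\<^sup>2 \<le> b\<^sup>2"
      using power_mono[OF that, of 2] by simp
    ultimately have "(k * \<mu> + k\<^sup>2 / 2) * h \<le> K * h"
      using h unfolding K_def barrier_rate_def b_def[symmetric] by (intro mult_right_mono) auto
    then show ?thesis by (simp add: algebra_simps)
  qed
  have bar: "barrier c a z = (exp (a * z) + exp (- a * z)) / 2 + exp (- b * z)" for z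
    by (simp add: barrier_def cosh_def b_def)
  define I where "I = (exp (a * y) * exp (a * \<mu> * h + a\<^sup>2 * h / 2) + exp (- a * y) * exp (- a * \<mu> * h + (- a)\<^sup>2 * h / 2)) / 2
     + exp (- b * y) * exp (- b * \<mu> * h + (- b)\<^sup>2 * h / 2)"
  have hb: "has_bochner_integral (gauss h) (\<lambda>s. barrier c a (y - \<eta> s)) I"
    unfolding bar I_def by (intro has_bochner_integral_add has_bochner_integral_divide_zero ex)
  have Ile: "I \<le> exp (K * h) * barrier c a y"
  proof -
    have "I \<le> (exp (a * y) * exp (K * h) + exp (- a * y) * exp (K * h)) / 2 + exp (- b * y) * exp (K * h)"
      unfolding I_def
      using a b by (intro add_mono divide_right_mono mult_left_mono exle) auto
    then show ?thesis by (simp add: bar algebra_simps)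
  qed
  have le: "barrier c a (max 0 (y - \<eta> s)) * exp (\<bar>c\<bar> * max 0 (\<eta> s - y)) + max 0 (\<eta> s - y) \<le> barrier c a (y - \<eta> s)" for s
  proof (cases "y \<ge> \<eta> s")
    case True then show ?thesis by simp
  next
    case False
    then show ?thesis using barrier_overshoot[of "\<eta> s - y" c a] by simp
  qed
  have nn: "barrier c a z \<ge> 0" for z using barrier_ge(2)[of c a z] by linarith
  have [measurable]: "barrier c a \<in> borel_measurable borel"
    unfolding barrier_def cosh_def by measurable
  have ib: "integrable (gauss h) (\<lambda>s. barrier c a (y - \<eta> s))"
    using hb by (simp add: has_bochner_integral_iff)
  have i1: "integrable (gauss h) (\<lambda>s. barrier c a (max 0 (y - \<eta> s)) * exp (\<bar>c\<bar> * max 0 (\<eta> s - y)))"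
  proof (rule Bochner_Integration.integrable_bound[OF ib])
    show "AE s in gauss h. norm (barrier c a (max 0 (y - \<eta> s)) * exp (\<bar>c\<bar> * max 0 (\<eta> s - y))) \<le> norm (barrier c a (y - \<eta> s))"
    proof (rule AE_I2)
      fix s
      show "norm (barrier c a (max 0 (y - \<eta> s)) * exp (\<bar>c\<bar> * max 0 (\<eta> s - y))) \<le> norm (barrier c a (y - \<eta> s))"
        using le[of s] nn[of "max 0 (y - \<eta> s)"] nn[of "y - \<eta> s"] by (auto simp: abs_mult)
    qed
  qed (simp add: \<eta>_def)
  have i2: "integrable (gauss h) (\<lambda>s. max 0 (\<eta> s - y))"
  proof (rule Bochner_Integration.integrable_bound[OF ib])
    show "AE s in gauss h. norm (max 0 (\<eta> s - y)) \<le> norm (barrier c a (y - \<eta> s))"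
    proof (rule AE_I2)
      fix s
      have "barrier c a (max 0 (y - \<eta> s)) * exp (\<bar>c\<bar> * max 0 (\<eta> s - y)) \<ge> 0"
        using nn by simp
      then show "norm (max 0 (\<eta> s - y)) \<le> norm (barrier c a (y - \<eta> s))"
        using le[of s] nn[of "y - \<eta> s"] by auto
    qed
  qed (simp add: \<eta>_def)
  show "integrable (gauss h) (\<lambda>s. barrier c a (max 0 (y - (s - \<mu> * h))) * exp (\<bar>c\<bar> * max 0 (s - \<mu> * h - y)))"
    "integrable (gauss h) (\<lambda>s. max 0 (s - \<mu> * h - y))"
    using i1 i2 by (simp_all add: \<eta>_def)
  have "robin_step (- \<bar>c\<bar>) \<mu> h (barrier c a) y + (\<integral>s. max 0 (\<eta> s - y) \<partial>gauss h)
      = (\<integral>s. barrier c a (max 0 (y - \<eta> s)) * exp (\<bar>c\<bar> * max 0 (\<eta> s - y)) + max 0 (\<eta> s - y) \<partial>gauss h)"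
    by (subst Bochner_Integration.integral_add[OF i1 i2]) (simp add: robin_step_def \<eta>_def)
  also have "\<dots> \<le> (\<integral>s. barrier c a (y - \<eta> s) \<partial>gauss h)"
    by (intro integral_mono Bochner_Integration.integrable_add i1 i2 ib le)
  also have "\<dots> = I" using hb by (simp add: has_bochner_integral_iff)
  finally show "robin_step (- \<bar>c\<bar>) \<mu> h (barrier c a) y
      \<le> exp (barrier_rate c \<mu> * h) * barrier c a y - (\<integral>s. max 0 (s - \<mu> * h - y) \<partial>gauss h)"
    using Ile by (simp add: \<eta>_def K_def)
qed

text \<open>The kernel of \<open>robin_step\<close> is positive and overshoots are nonnegative, so
  the weight with \<open>- \<bar>c\<bar>\<close> dominates the one with \<open>c\<close> for either
  sign of \<open>c\<close>.\<close>

lemma robin_step_abs_le: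
  assumes h: "h > 0" and y: "y \<ge> 0" and a: "0 \<le> a" "a \<le> 1"
    and g: "g \<in> borel_measurable borel" "\<And>z. z \<ge> 0 \<Longrightarrow> \<bar>g z\<bar> \<le> A * barrier c a z"
  shows "\<bar>robin_step c \<mu> h g y\<bar> \<le> A * robin_step (- \<bar>c\<bar>) \<mu> h (barrier c a) y"
proof -
  have i: "integrable (gauss h) (\<lambda>s. A * (barrier c a (max 0 (y - (s - \<mu> * h))) * exp (\<bar>c\<bar> * max 0 (s - \<mu> * h - y))))"
    using robin_step_barrier(1)[OF h y a] by simp
  have le: "\<bar>g (max 0 (y - (s - \<mu> * h))) * exp (- c * max 0 (s - \<mu> * h - y))\<bar>
      \<le> A * (barrier c a (max 0 (y - (s - \<mu> * h))) * exp (\<bar>c\<bar> * max 0 (s - \<mu> * h - y)))" for s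
  proof -
    have "- c * max 0 (s - \<mu> * h - y) \<le> \<bar>c\<bar> * max 0 (s - \<mu> * h - y)" by (intro mult_right_mono) auto
    then have "\<bar>g (max 0 (y - (s - \<mu> * h)))\<bar> * exp (- c * max 0 (s - \<mu> * h - y))
      \<le> (A * barrier c a (max 0 (y - (s - \<mu> * h)))) * exp (\<bar>c\<bar> * max 0 (s - \<mu> * h - y))"
      using g(2)[of 0] by (intro mult_mono g(2)) (auto intro: order_trans[OF abs_ge_zero g(2)])
    then show ?thesis by (simp add: abs_mult mult.assoc)
  qed
  have [measurable]: "g \<in> borel_measurable borel" by fact
  have "\<bar>robin_step c \<mu> h g y\<bar> \<le> (\<integral>s. \<bar>g (max 0 (y - (s - \<mu> * h))) * exp (- c * max 0 (s - \<mu> * h - y))\<bar> \<partial>gauss h)"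
    unfolding robin_step_def by (rule integral_abs_bound)
  also have "\<dots> \<le> (\<integral>s. A * (barrier c a (max 0 (y - (s - \<mu> * h))) * exp (\<bar>c\<bar> * max 0 (s - \<mu> * h - y))) \<partial>gauss h)"
    by (intro integral_mono_AE'[OF i] AE_I2 le order_trans[OF abs_ge_zero le])
  finally show ?thesis by (simp add: robin_step_def)
qed

text \<open>On the half line \<open>barrier c 0\<close> lies between 1 and 2, so passing from the
  constant \<open>C\<close> to the barrier and back costs only the factor 2. The bound sees the mesh
  only through the elapsed time \<open>k * h\<close>.\<close>

lemma robin_step_funpow_bounds:
  assumes h: "h > 0" and g: "g \<in> borel_measurable borel" "\<And>z. z \<ge> 0 \<Longrightarrow> \<bar>g z\<bar> \<le> C"
  shows "(robin_step c \<mu> h ^^ k) g \<in> borel_measurable borel"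
    and "y \<ge> 0 \<Longrightarrow> \<bar>(robin_step c \<mu> h ^^ k) g y\<bar> \<le> 2 * C * exp (barrier_rate c \<mu> * (k * h))"
proof -
  show m: "(robin_step c \<mu> h ^^ k) g \<in> borel_measurable borel" for k
    by (induction k) (use g h in auto)
  let ?K = "barrier_rate c \<mu>"
  have C: "C \<ge> 0" using g(2)[of 0] by linarith
  have le: "y \<ge> 0 \<Longrightarrow> \<bar>(robin_step c \<mu> h ^^ k) g y\<bar> \<le> C * exp (?K * (k * h)) * barrier c 0 y" for y
  proof (induction k arbitrary: y)
    case 0
    have "C * 1 \<le> C * barrier c 0 y" using C barrier_ge(2) by (intro mult_left_mono) auto
    then show ?case using g(2)[OF 0] by simp
  next
    case (Suc k)
    have nn: "0 \<le> (\<integral>s. max 0 (s - \<mu> * h - y) \<partial>gauss h)" by (rule integral_nonneg_AE) auto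
    have "\<bar>(robin_step c \<mu> h ^^ Suc k) g y\<bar> \<le> (C * exp (?K * (k * h))) * robin_step (- \<bar>c\<bar>) \<mu> h (barrier c 0) y"
      unfolding funpow.simps o_def
      by (rule robin_step_abs_le[OF h Suc.prems]) (use m Suc.IH in auto)
    also have "\<dots> \<le> (C * exp (?K * (k * h))) * (exp (?K * h) * barrier c 0 y)"
    proof (rule mult_left_mono)
      show "robin_step (- \<bar>c\<bar>) \<mu> h (barrier c 0) y \<le> exp (?K * h) * barrier c 0 y"
        using robin_step_barrier(3)[OF h Suc.prems, of 0 c \<mu>, simplified] nn by linarith
    qed (use C in simp)
    finally show ?case by (simp add: exp_add[symmetric] algebra_simps)
  qed
  show "\<bar>(robin_step c \<mu> h ^^ k) g y\<bar> \<le> 2 * C * exp (?K * (k * h))" if "y \<ge> 0"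
  proof -
    have "barrier c 0 y \<le> 2" using that by (simp add: barrier_def mult_nonpos_nonneg)
    then have "C * exp (?K * (k * h)) * barrier c 0 y \<le> C * exp (?K * (k * h)) * 2"
      using C by (intro mult_left_mono) auto
    then show ?thesis using le[OF that] by simp
  qed
qed

text \<open>A discrete maximum principle. Beyond \<open>R\<close> nothing is known about the one-step error, but there
  the barrier already exceeds the crude bound on both functions.\<close>

lemma robin_step_comparison:
  fixes w :: "nat \<Rightarrow> real \<Rightarrow> real" and n :: nat and h \<delta> :: real
  assumes h: "h > 0" and \<delta>: "\<delta> > 0"
    and w: "\<And>k. k \<le> n \<Longrightarrow> w k \<in> borel_measurable borel"
    and wC: "\<And>k z. k \<le> n \<Longrightarrow> z \<ge> 0 \<Longrightarrow> \<bar>w k z\<bar> \<le> C"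
    and step: "\<And>k y. k < n \<Longrightarrow> 0 \<le> y \<Longrightarrow> y \<le> R \<Longrightarrow>
       \<bar>robin_step c \<mu> h (w k) y - w (Suc k) y\<bar> \<le> \<delta> * h + \<delta> * (\<integral>s. max 0 (s - \<mu> * h - y) \<partial>gauss h)"
    and R: "R \<ge> 0" "C * (1 + 2 * exp (barrier_rate c \<mu> * (n * h))) \<le> \<delta> * cosh R"
  shows "k \<le> n \<Longrightarrow> y \<ge> 0 \<Longrightarrow>
    \<bar>(robin_step c \<mu> h ^^ k) (w 0) y - w k y\<bar> \<le> \<delta> * exp ((barrier_rate c \<mu> + 1) * (k * h)) * barrier c 1 y"
proof (induction k arbitrary: y)
  case 0
  then show ?case using \<delta> barrier_ge(2)[of c 1 y] by simp
next
  case (Suc k)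
  let ?K = "barrier_rate c \<mu>" and ?Q = "robin_step c \<mu> h"
  have K: "?K \<ge> 0" by (simp add: barrier_rate_def)
  have "\<bar>w 0 0\<bar> \<le> C" by (rule wC) auto
  then have C: "C \<ge> 0" by linarith
  have m: "(?Q ^^ k) (w 0) \<in> borel_measurable borel" "\<And>z. z \<ge> 0 \<Longrightarrow> \<bar>(?Q ^^ k) (w 0) z\<bar> \<le> 2 * C * exp (?K * (k * h))"
    for k using robin_step_funpow_bounds[OF h w[OF le0], of C] wC[OF le0] by simp_all
  show ?case
  proof (cases "y \<le> R")
    case False
    have "cosh R \<le> cosh y" using False R by (intro cosh_real_nonneg_le_iff[THEN iffD2]) auto
    also have "\<dots> \<le> barrier c 1 y" using barrier_ge(1)[of 1 y c] by simp
    finally have "\<delta> * cosh R \<le> \<delta> * 1 * barrier c 1 y" using \<delta> by simp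
    also have "\<dots> \<le> \<delta> * exp ((?K + 1) * (Suc k * h)) * barrier c 1 y"
      using \<delta> K h barrier_ge(2)[of c 1 y] by (intro mult_right_mono mult_left_mono) auto
    finally have 1: "\<delta> * cosh R \<le> \<delta> * exp ((?K + 1) * (Suc k * h)) * barrier c 1 y" .
    have "\<bar>(?Q ^^ Suc k) (w 0) y\<bar> \<le> 2 * C * exp (?K * (Suc k * h))"
      by (rule m(2)[OF Suc.prems(2)])
    also have "\<dots> \<le> 2 * C * exp (?K * (n * h))"
      using C K h Suc.prems(1) by (intro mult_left_mono) (auto intro!: mult_left_mono mult_right_mono simp del: of_nat_Suc)
    finally have "\<bar>(?Q ^^ Suc k) (w 0) y - w (Suc k) y\<bar> \<le> C * (1 + 2 * exp (?K * (n * h)))"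
      using wC[OF Suc.prems] by (simp add: algebra_simps del: funpow.simps)
    then show ?thesis using 1 R(2) by linarith
  next
    case True
    let ?E = "\<integral>s. max 0 (s - \<mu> * h - y) \<partial>gauss h"
    let ?q = "exp ((?K + 1) * (k * h))"
    have nn: "0 \<le> ?E" by (rule integral_nonneg_AE) auto
    have k: "k \<le> n" "k < n" using Suc.prems by auto
    have [measurable]: "w k \<in> borel_measurable borel" "(?Q ^^ k) (w 0) \<in> borel_measurable borel" using w m k by auto
    have q1: "?q \<ge> 1" using K h by simp
    have "?Q (\<lambda>z. (?Q ^^ k) (w 0) z - w k z) y = ?Q ((?Q ^^ k) (w 0)) y - ?Q (w k) y"
      unfolding robin_step_def[of _ _ _ _ y] left_diff_distrib
      by (rule Bochner_Integration.integral_diff)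
         (use robin_step_integrable[OF h Suc.prems(2) m] robin_step_integrable[OF h Suc.prems(2) w[OF k(1)] wC[OF k(1)]] in simp_all)
    moreover have "\<bar>?Q (\<lambda>z. (?Q ^^ k) (w 0) z - w k z) y\<bar> \<le> \<delta> * ?q * robin_step (- \<bar>c\<bar>) \<mu> h (barrier c 1) y"
      by (rule robin_step_abs_le[OF h Suc.prems(2)]) (use Suc.IH k in auto)
    moreover have "\<delta> * ?q * robin_step (- \<bar>c\<bar>) \<mu> h (barrier c 1) y \<le> \<delta> * ?q * (exp (?K * h) * barrier c 1 y - ?E)"
      using robin_step_barrier(3)[OF h Suc.prems(2), of 1 c \<mu>] \<delta> by (intro mult_left_mono) auto
    \<comment> \<open>The boundary part of the new one-step error is cancelled by the overshoot that
      the barrier gives up; the accumulated factor \<open>?q\<close> only enlarges that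
      slack.\<close>
    moreover have "\<delta> * ?E \<le> \<delta> * ?q * ?E"
      using q1 \<delta> nn by (simp add: mult_right_mono)
    moreover have "\<delta> * h \<le> \<delta> * ?q * (h * barrier c 1 y)"
    proof -
      have "1 * (h * 1) \<le> ?q * (h * barrier c 1 y)" using q1 h barrier_ge(2) by (intro mult_mono) auto
      then show ?thesis using \<delta> by (simp add: mult.assoc)
    qed
    \<comment> \<open>The interior part of the new error is absorbed by raising the growth rate from
      \<open>?K\<close> to \<open>?K + 1\<close>.\<close>
    moreover have "\<delta> * ?q * ((exp (?K * h) + h) * barrier c 1 y) \<le> \<delta> * ?q * (exp ((?K + 1) * h) * barrier c 1 y)"
    proof -
      have "exp (?K * h) * (1 + h) \<le> exp (?K * h) * exp h" using exp_ge_add_one_self by (intro mult_left_mono) auto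
      moreover have "1 * h \<le> exp (?K * h) * h" using K h by (intro mult_right_mono) auto
      ultimately have "exp (?K * h) + h \<le> exp ((?K + 1) * h)" by (simp add: exp_add algebra_simps)
      then show ?thesis using \<delta> barrier_ge(2)[of c 1 y] by (intro mult_left_mono mult_right_mono) auto
    qed
    moreover note step[OF k(2) Suc.prems(2) True]
    moreover have "\<delta> * ?q * (exp ((?K + 1) * h) * barrier c 1 y) = \<delta> * exp ((?K + 1) * (Suc k * h)) * barrier c 1 y"
    proof -
      have "?q * exp ((?K + 1) * h) = exp ((?K + 1) * (Suc k * h))"
        by (simp add: exp_add[symmetric] algebra_simps)
      then show ?thesis by (metis mult.assoc)
    qed
    moreover have "\<delta> * ?q * (exp (?K * h) * barrier c 1 y - ?E) = \<delta> * ?q * (exp (?K * h) * barrier c 1 y) - \<delta> * ?q * ?E"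
      "\<delta> * ?q * ((exp (?K * h) + h) * barrier c 1 y) = \<delta> * ?q * (exp (?K * h) * barrier c 1 y) + \<delta> * ?q * (h * barrier c 1 y)"
      by (simp_all only: distrib_left distrib_right right_diff_distrib)
    ultimately show ?thesis
      unfolding funpow.simps o_def by linarith
  qed
qed

subsection \<open>Consistency of one step\<close>

lemma exp_linear_remainder:
  fixes x b :: real
  assumes "\<bar>x\<bar> \<le> b"
  shows "\<bar>exp x - 1 - x\<bar> \<le> exp b * x\<^sup>2"
proof -
  have "norm (exp x - (\<Sum>i\<le>1. exp 0 * (x - 0) ^ i / fact i)) \<le> exp b * norm (x - 0) ^ Suc 1 / fact 1"
    by (rule field_Taylor[where S="{-b..b}" and f="\<lambda>_. exp"])
       (use assms in \<open>auto intro!: derivative_eq_intros\<close>)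
  then show ?thesis by (simp add: algebra_simps power2_eq_square[symmetric] numeral_2_eq_2[symmetric])
qed

text \<open>The Robin condition turns the weight into an extension beyond 0: to first order, p0(0)
  exp (- c m) = p0(0) - m p1(0), the tangent line of \<open>p0\<close> at 0 continued to - m.
  Reflection with weight thus agrees with the Taylor polynomial at the unreflected point
  \<open>y - \<eta>\<close>, up to cubic terms in \<eta> and quadratic terms in the overshoot
  \<open>m\<close>.\<close>

lemma robin_overshoot_taylor:
  fixes p0 p1 p2 p3 :: "real \<Rightarrow> real" and c C R y \<eta> :: real
  assumes d: "\<And>z. z \<in> {0..R+1} \<Longrightarrow> (p0 has_real_derivative p1 z) (at z within {0..R+1})"
             "\<And>z. z \<in> {0..R+1} \<Longrightarrow> (p1 has_real_derivative p2 z) (at z within {0..R+1})"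
             "\<And>z. z \<in> {0..R+1} \<Longrightarrow> (p2 has_real_derivative p3 z) (at z within {0..R+1})"
    and bound: "\<And>z. z \<in> {0..R+1} \<Longrightarrow> \<bar>p1 z\<bar> \<le> C" "\<And>z. z \<in> {0..R+1} \<Longrightarrow> \<bar>p2 z\<bar> \<le> C"
      "\<And>z. z \<in> {0..R+1} \<Longrightarrow> \<bar>p3 z\<bar> \<le> C" "\<And>z. z \<ge> 0 \<Longrightarrow> \<bar>p0 z\<bar> \<le> C"
    and robin: "p1 0 = c * p0 0"
    and y: "0 \<le> y" "y \<le> R"
  defines "m \<equiv> max 0 (\<eta> - y)"
  shows "\<bar>p0 (max 0 (y - \<eta>)) * exp (- c * m) - (p0 y - p1 y * \<eta> + p2 y / 2 * \<eta>\<^sup>2)\<bar>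
    \<le> 4 * C * (\<bar>\<eta>\<bar> ^ 3 * exp (\<bar>c\<bar> * \<bar>\<eta>\<bar>)) + C * (c\<^sup>2 * exp \<bar>c\<bar> + 1) * m\<^sup>2"
proof -
  have C: "C \<ge> 0" using bound(4)[of 0] by linarith
  have yS: "y \<in> {0..R+1}" "0 \<in> {0..R+1}" using y by auto
  note bb = bound(1,2)[OF yS(1)] bound(4)[OF y(1)]
  have m0: "m \<ge> 0" by (simp add: m_def)
  have D0: "C * (c\<^sup>2 * exp \<bar>c\<bar> + 1) * m\<^sup>2 \<ge> 0" using C by simp
  have e1: "exp (\<bar>c\<bar> * \<bar>\<eta>\<bar>) \<ge> 1" by simp
  define e where "e = \<bar>\<eta>\<bar>"
  have e0: "e \<ge> 0" by (simp add: e_def)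
  have T2: "\<bar>p0 z - (p0 y + p1 y * (z - y) + p2 y * (z - y)\<^sup>2 / 2)\<bar> \<le> C * \<bar>z - y\<bar> ^ 3 / 2" if "z \<in> {0..R+1}" for z
  proof -
    \<comment> \<open>The list packages the successive derivatives as the indexed family that
      \<open>field_Taylor\<close> expects.\<close>
    have "norm ((\<lambda>i. [p0,p1,p2,p3] ! i) 0 z - (\<Sum>i\<le>2. ([p0,p1,p2,p3] ! i) y * (z - y) ^ i / fact i))
      \<le> C * norm (z - y) ^ Suc 2 / fact 2"
    proof (rule field_Taylor[where S="{0..R+1}"])
      fix i x assume "x \<in> {0..R+1}" "i \<le> (2::nat)"
      then show "([p0,p1,p2,p3] ! i has_field_derivative ([p0,p1,p2,p3] ! Suc i) x) (at x within {0..R+1})"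
        using d by (auto simp: le_Suc_eq numeral_2_eq_2)
    qed (use bound(3) that yS in \<open>auto simp: numeral_2_eq_2\<close>)
    then show ?thesis by (simp add: numeral_2_eq_2 numeral_3_eq_3)
  qed
  have T1: "\<bar>p1 0 - (p1 y - p2 y * y)\<bar> \<le> C * y\<^sup>2"
  proof -
    have "norm ((\<lambda>i. [p1,p2,p3] ! i) 0 0 - (\<Sum>i\<le>1. ([p1,p2,p3] ! i) y * (0 - y) ^ i / fact i))
      \<le> C * norm (0 - y) ^ Suc 1 / fact 1"
    proof (rule field_Taylor[where S="{0..R+1}"])
      fix i x assume "x \<in> {0..R+1}" "i \<le> (1::nat)"
      then show "([p1,p2,p3] ! i has_field_derivative ([p1,p2,p3] ! Suc i) x) (at x within {0..R+1})"
        using d by (auto simp: le_Suc_eq)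
    qed (use bound(3) yS in auto)
    then show ?thesis using y by (simp add: power2_eq_square)
  qed
  consider "\<bar>\<eta>\<bar> > 1" | "\<bar>\<eta>\<bar> \<le> 1" "\<eta> \<le> y" | "\<bar>\<eta>\<bar> \<le> 1" "\<eta> > y" by linarith
  then show ?thesis
  proof cases
    \<comment> \<open>The point may leave the interval where derivatives are controlled, so no
      expansion is used: each term is bounded by a constant times the cube of a quantity larger than
      1.\<close>
    case 1
    have "\<bar>p0 (max 0 (y - \<eta>)) * exp (- c * m)\<bar> \<le> C * exp (\<bar>c\<bar> * \<bar>\<eta>\<bar>)"
      unfolding abs_mult abs_exp_cancel m_def
      using C y by (intro mult_mono bound(4) overshoot_exp_le) auto
    also have "\<dots> \<le> C * (e ^ 3 * exp (\<bar>c\<bar> * \<bar>\<eta>\<bar>))"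
    proof -
      have "1 * exp (\<bar>c\<bar> * \<bar>\<eta>\<bar>) \<le> e ^ 3 * exp (\<bar>c\<bar> * \<bar>\<eta>\<bar>)"
        using 1 by (intro mult_right_mono one_le_power) (auto simp: e_def)
      then show ?thesis using C by (simp add: mult_left_mono)
    qed
    finally have a: "\<bar>p0 (max 0 (y - \<eta>)) * exp (- c * m)\<bar> \<le> C * (e ^ 3 * exp (\<bar>c\<bar> * \<bar>\<eta>\<bar>))" .
    have "\<bar>p0 y\<bar> \<le> C * e ^ 3"
      using 1 C bb(3) mult_left_mono[OF one_le_power[of e 3], of C] by (simp add: e_def)
    moreover have "\<bar>p1 y * \<eta>\<bar> \<le> C * e ^ 3"
      unfolding abs_mult using 1 C bb(1) power_increasing[of 1 3 e]
      by (intro mult_mono) (auto simp: e_def)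
    moreover have "\<bar>p2 y / 2 * \<eta>\<^sup>2\<bar> \<le> C * e ^ 3"
      unfolding abs_mult using 1 C bb(2) power_increasing[of 2 3 e]
      by (intro mult_mono) (auto simp: e_def)
    moreover have X: "C * e ^ 3 \<le> C * (e ^ 3 * exp (\<bar>c\<bar> * \<bar>\<eta>\<bar>))"
      using C e0 e1 by (intro mult_left_mono) (simp_all add: mult_le_cancel_left1)
    moreover have "\<bar>x1 - (x2 - x3 + x4)\<bar> \<le> \<bar>x1\<bar> + (\<bar>x2\<bar> + \<bar>x3\<bar> + \<bar>x4\<bar>)" for x1 x2 x3 x4 :: real
      by linarith
    ultimately have "\<bar>p0 (max 0 (y - \<eta>)) * exp (- c * m) - (p0 y - p1 y * \<eta> + p2 y / 2 * \<eta>\<^sup>2)\<bar>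
        \<le> C * (e ^ 3 * exp (\<bar>c\<bar> * \<bar>\<eta>\<bar>)) + (C * e ^ 3 + C * e ^ 3 + C * e ^ 3)"
      by (meson a add_mono order_trans)
    then show ?thesis using X D0 unfolding e_def by linarith
  next
    case 2
    have "y - \<eta> \<in> {0..R+1}" using 2 y by auto
    from T2[OF this] have "\<bar>p0 (y - \<eta>) - (p0 y - p1 y * \<eta> + p2 y / 2 * \<eta>\<^sup>2)\<bar> \<le> C * e ^ 3 / 2"
      by (simp add: e_def)
    moreover have "C * e ^ 3 \<le> C * (e ^ 3 * exp (\<bar>c\<bar> * \<bar>\<eta>\<bar>))"
      using C e0 e1 by (intro mult_left_mono) (simp_all add: mult_le_cancel_left1)
    moreover have "C * e ^ 3 \<ge> 0" using C e0 by simp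
    moreover have "m = 0" "max 0 (y - \<eta>) = y - \<eta>" using 2 by (auto simp: m_def)
    ultimately show ?thesis unfolding e_def by simp
  next
    case 3
    have m: "m = \<eta> - y" "max 0 (y - \<eta>) = 0" using 3 by (auto simp: m_def)
    have eta: "\<eta> = y + m" "e = y + m" using m m0 y by (auto simp: e_def)
    have m1: "m \<le> 1" using 3 m y by auto
    define r where "r = exp (- c * m) - 1 - (- c * m)"
    have "\<bar>c * m\<bar> \<le> \<bar>c\<bar>" using m0 m1 by (simp add: abs_mult mult_left_le)
    then have r: "\<bar>r\<bar> \<le> exp \<bar>c\<bar> * (c * m)\<^sup>2"
      using exp_linear_remainder[of "- c * m" "\<bar>c\<bar>"] by (simp add: r_def)
    define a0 where "a0 = p0 0 - (p0 y - p1 y * y + p2 y * y\<^sup>2 / 2)"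
    define a1 where "a1 = p1 0 - (p1 y - p2 y * y)"
    have a0: "\<bar>a0\<bar> \<le> C * y ^ 3 / 2" using T2[OF yS(2)] y by (simp add: a0_def)
    \<comment> \<open>Expansion with \<open>\<eta> = y + m\<close>: \<open>a0\<close> and
      \<open>a1\<close> are Taylor remainders of \<open>p0\<close> and \<open>p1\<close> from
      \<open>y\<close> to 0, and \<open>r\<close> is that of the exponential. Since \<open>y\<close>
      and \<open>m\<close> are both at most \<open>e\<close>, the terms with \<open>a0\<close> and
      \<open>m * a1\<close> are cubic in \<open>e\<close>; the remaining two are quadratic in
      \<open>m\<close>.\<close>
    have "p0 0 * exp (- c * m) - (p0 y - p1 y * \<eta> + p2 y / 2 * \<eta>\<^sup>2) = a0 - m * a1 + p0 0 * r - p2 y / 2 * m\<^sup>2"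
      unfolding a0_def a1_def r_def robin eta by (simp add: algebra_simps power2_eq_square)
    moreover have "\<bar>m * a1\<bar> \<le> C * e ^ 3"
    proof -
      have "m * \<bar>a1\<bar> \<le> e * (C * e\<^sup>2)"
        using T1 m0 eta y C unfolding a1_def
        by (intro mult_mono order_trans[OF T1] mult_left_mono power_mono) auto
      then show ?thesis using m0 by (simp add: abs_mult power2_eq_square power3_eq_cube algebra_simps)
    qed
    moreover have "C * y ^ 3 \<le> C * e ^ 3"
      using C eta m0 y by (intro mult_left_mono power_mono) auto
    moreover have "\<bar>p0 0 * r\<bar> \<le> C * (exp \<bar>c\<bar> * (c * m)\<^sup>2)"
      unfolding abs_mult using r C by (intro mult_mono bound(4)) auto
    moreover have "\<bar>p2 y / 2 * m\<^sup>2\<bar> \<le> C * m\<^sup>2"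
      unfolding abs_mult using bb(2) C by (intro mult_mono) auto
    moreover have "C * (c\<^sup>2 * exp \<bar>c\<bar> + 1) * m\<^sup>2 = C * (exp \<bar>c\<bar> * (c * m)\<^sup>2) + C * m\<^sup>2"
      by (simp add: algebra_simps power_mult_distrib)
    moreover have "C * e ^ 3 \<le> C * (e ^ 3 * exp (\<bar>c\<bar> * \<bar>\<eta>\<bar>))"
      using C e0 e1 by (intro mult_left_mono) (simp_all add: mult_le_cancel_left1)
    moreover have "C * e ^ 3 \<ge> 0" using C e0 by simp
    ultimately show ?thesis using a0 unfolding m(2) e_def[symmetric] by linarith
  qed
qed

text \<open>The first two moments of \<open>s - \<mu> * h\<close> turn the Taylor polynomial into
  the generator plus a term in \<mu>^2 h^2. The squared overshoot has mean up to order h and is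
  split by m^2 \<le> \<theta> m + m^3 / \<theta>: the first part is charged to the expected
  overshoot with a coefficient at the disposal of \<theta>, the second is of order h sqrt h because
  \<open>m\<close> is at most the modulus of the increment.\<close>

lemma robin_step_taylor:
  fixes p0 p1 p2 p3 :: "real \<Rightarrow> real" and c C R y h \<mu> \<theta> :: real
  assumes d: "\<And>z. z \<in> {0..R+1} \<Longrightarrow> (p0 has_real_derivative p1 z) (at z within {0..R+1})"
             "\<And>z. z \<in> {0..R+1} \<Longrightarrow> (p1 has_real_derivative p2 z) (at z within {0..R+1})"
             "\<And>z. z \<in> {0..R+1} \<Longrightarrow> (p2 has_real_derivative p3 z) (at z within {0..R+1})"
    and bound: "\<And>z. z \<in> {0..R+1} \<Longrightarrow> \<bar>p1 z\<bar> \<le> C" "\<And>z. z \<in> {0..R+1} \<Longrightarrow> \<bar>p2 z\<bar> \<le> C"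
      "\<And>z. z \<in> {0..R+1} \<Longrightarrow> \<bar>p3 z\<bar> \<le> C" "\<And>z. z \<ge> 0 \<Longrightarrow> \<bar>p0 z\<bar> \<le> C"
    and meas: "p0 \<in> borel_measurable borel"
    and robin: "p1 0 = c * p0 0"
    and y: "0 \<le> y" "y \<le> R" and h: "0 < h" "h \<le> 1" and \<theta>: "\<theta> > 0"
  defines "D \<equiv> c\<^sup>2 * exp \<bar>c\<bar> + 1"
    and "G \<equiv> 54 * exp ((1 + \<bar>c\<bar>) * \<bar>\<mu>\<bar> + (1 + \<bar>c\<bar>)\<^sup>2 / 2)"
  shows "\<bar>robin_step c \<mu> h p0 y - (p0 y + h * (\<mu> * p1 y + p2 y / 2))\<bar>
    \<le> C * (4 + D / \<theta>) * G * (h * sqrt h) + C * \<mu>\<^sup>2 * h\<^sup>2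
      + C * D * \<theta> * (\<integral>s. max 0 (s - \<mu> * h - y) \<partial>gauss h)"
proof -
  interpret prob_space "gauss h" by (rule prob_space_gauss[OF h(1)])
  define \<eta> where "\<eta> = (\<lambda>s. s - \<mu> * h)"
  define m where "m = (\<lambda>s. max 0 (\<eta> s - y))"
  define T where "T = (\<lambda>s. p0 y - p1 y * \<eta> s + p2 y / 2 * (\<eta> s)\<^sup>2)"
  define q where "q = (\<lambda>s. \<bar>\<eta> s\<bar> ^ 3 * exp (\<bar>c\<bar> * \<bar>\<eta> s\<bar>))"
  define F where "F = (\<lambda>s. p0 (max 0 (y - \<eta> s)) * exp (- c * m s))"
  have C: "C \<ge> 0" using bound(4)[of 0] by linarith
  have D: "D \<ge> 0" by (simp add: D_def)
  have q: "integrable (gauss h) q" "integral\<^sup>L (gauss h) q \<le> G * (h * sqrt h)"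
    using gauss_cube_exp[OF h, of "\<bar>c\<bar>" \<mu>] by (simp_all add: q_def \<eta>_def G_def)
  have mi: "integrable (gauss h) m"
    using robin_step_barrier(2)[OF h(1) y(1), of 0] by (simp add: m_def \<eta>_def)
  have Fi: "integrable (gauss h) F"
    using robin_step_integrable[OF h(1) y(1) meas, of C] bound(4) by (simp add: F_def m_def \<eta>_def)
  note mom = gauss_moments[OF h(1), unfolded has_bochner_integral_iff]
  have Teq: "T = (\<lambda>s. (p0 y + p1 y * \<mu> * h + p2 y / 2 * (\<mu> * h)\<^sup>2) + (- p1 y - p2 y * \<mu> * h) * s + p2 y / 2 * s\<^sup>2)"
    by (simp add: T_def \<eta>_def fun_eq_iff power2_eq_square field_simps)
  have Ti: "integrable (gauss h) T" "integral\<^sup>L (gauss h) T = p0 y + p1 y * \<mu> * h + p2 y / 2 * (\<mu> * h)\<^sup>2 + p2 y / 2 * h"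
    unfolding Teq using mom by (simp_all add: prob_space[simplified])
  have pt: "\<bar>F s - T s\<bar> \<le> C * (4 + D / \<theta>) * q s + C * D * \<theta> * m s" for s
  proof -
    have m0: "m s \<ge> 0" "m s \<le> \<bar>\<eta> s\<bar>" using y by (auto simp: m_def)
    have "(m s)\<^sup>2 \<le> \<theta> * m s + (m s) ^ 3 / \<theta>"
    proof (cases "m s \<le> \<theta>")
      case True
      have "(m s)\<^sup>2 \<le> \<theta> * m s" using True m0 by (simp add: power2_eq_square mult_right_mono)
      then show ?thesis using m0 \<theta> by (simp add: add_increasing2)
    next
      case False
      then have "(m s)\<^sup>2 * \<theta> \<le> (m s)\<^sup>2 * m s" by (intro mult_left_mono) auto
      then have "(m s)\<^sup>2 \<le> (m s) ^ 3 / \<theta>" using \<theta> by (simp add: field_simps power2_eq_square power3_eq_cube)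
      then show ?thesis using m0 \<theta> by (simp add: add_increasing)
    qed
    also have "(m s) ^ 3 / \<theta> \<le> q s / \<theta>"
    proof -
      have "(m s) ^ 3 * 1 \<le> q s" unfolding q_def using m0 by (intro mult_mono power_mono) auto
      then show ?thesis using \<theta> by (simp add: divide_right_mono)
    qed
    finally have "C * D * (m s)\<^sup>2 \<le> C * D * (\<theta> * m s + q s / \<theta>)"
      using C D by (intro mult_left_mono) auto
    moreover have "\<bar>F s - T s\<bar> \<le> 4 * C * q s + C * D * (m s)\<^sup>2"
      using robin_overshoot_taylor[OF d bound robin y, of "\<eta> s"]
      by (simp add: F_def T_def q_def D_def m_def)
    ultimately show ?thesis by (simp add: algebra_simps)
  qed
  have "\<bar>integral\<^sup>L (gauss h) F - integral\<^sup>L (gauss h) T\<bar> = \<bar>\<integral>s. F s - T s \<partial>gauss h\<bar>"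
    using Fi Ti by simp
  also have "\<dots> \<le> (\<integral>s. \<bar>F s - T s\<bar> \<partial>gauss h)" by (rule integral_abs_bound)
  also have "\<dots> \<le> (\<integral>s. C * (4 + D / \<theta>) * q s + C * D * \<theta> * m s \<partial>gauss h)"
    using Fi Ti(1) q mi pt by (intro integral_mono) auto
  also have "\<dots> = C * (4 + D / \<theta>) * integral\<^sup>L (gauss h) q + C * D * \<theta> * integral\<^sup>L (gauss h) m"
    using q mi by simp
  also have "\<dots> \<le> C * (4 + D / \<theta>) * (G * (h * sqrt h)) + C * D * \<theta> * integral\<^sup>L (gauss h) m"
    using q C D \<theta> by (intro add_right_mono mult_left_mono) auto
  finally have 1: "\<bar>integral\<^sup>L (gauss h) F - integral\<^sup>L (gauss h) T\<bar> \<le> \<dots>" .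
  have "\<bar>integral\<^sup>L (gauss h) T - (p0 y + h * (\<mu> * p1 y + p2 y / 2))\<bar> \<le> C * \<mu>\<^sup>2 * h\<^sup>2"
  proof -
    have "integral\<^sup>L (gauss h) T - (p0 y + h * (\<mu> * p1 y + p2 y / 2)) = p2 y / 2 * (\<mu>\<^sup>2 * h\<^sup>2)"
      by (simp add: Ti power_mult_distrib algebra_simps)
    moreover have "\<bar>p2 y\<bar> \<le> C" using bound(2)[of y] y by auto
    then have "\<bar>p2 y / 2 * (\<mu>\<^sup>2 * h\<^sup>2)\<bar> \<le> C * (\<mu>\<^sup>2 * h\<^sup>2)"
      unfolding abs_mult using C by (intro mult_mono) auto
    ultimately show ?thesis by (metis mult.assoc)
  qed
  moreover have "\<bar>x1 - x3\<bar> \<le> \<bar>x1 - x2\<bar> + \<bar>x2 - x3\<bar>" for x1 x2 x3 :: real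
    by linarith
  ultimately have "\<bar>integral\<^sup>L (gauss h) F - (p0 y + h * (\<mu> * p1 y + p2 y / 2))\<bar>
      \<le> (C * (4 + D / \<theta>) * (G * (h * sqrt h)) + C * D * \<theta> * integral\<^sup>L (gauss h) m) + C * \<mu>\<^sup>2 * h\<^sup>2"
    using 1 by (meson add_mono order_trans)
  moreover have "robin_step c \<mu> h p0 y = integral\<^sup>L (gauss h) F"
    "(\<integral>s. max 0 (s - \<mu> * h - y) \<partial>gauss h) = integral\<^sup>L (gauss h) m"
    by (simp_all add: robin_step_def F_def m_def \<eta>_def)
  ultimately show ?thesis by (simp add: mult.assoc)
qed

subsection \<open>Convergence of the iterated step\<close>

lemma C_inf_on_imp_continuous_on: "C_inf_on S g \<Longrightarrow> continuous_on S g"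
  unfolding C_inf_on_def by blast

text \<open>The family that witnesses smoothness of \<open>g\<close> witnesses it for both partial
  derivatives, so the lemma can be iterated. Slices in time are open, hence the two-sided derivative
  there.\<close>

lemma C_inf_on_halfplane_derivs:
  assumes "C_inf_on ({0<..} \<times> {0..}) g"
  obtains gt gx where "C_inf_on ({0<..} \<times> {0..}) gt" "C_inf_on ({0<..} \<times> {0..}) gx"
    "\<And>t x. t > 0 \<Longrightarrow> x \<ge> 0 \<Longrightarrow> ((\<lambda>s. g (s, x)) has_real_derivative gt (t, x)) (at t)"
    "\<And>t x. t > 0 \<Longrightarrow> x \<ge> 0 \<Longrightarrow> ((\<lambda>y. g (t, y)) has_real_derivative gx (t, x)) (at x within {0..})"
proof -
  let ?S = "{0<..} \<times> {0..} :: (real \<times> real) set"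
  from assms obtain F where F: "g \<in> F"
    "\<forall>h\<in>F. continuous_on ?S h \<and> (\<exists>h1\<in>F. \<exists>h2\<in>F. \<forall>p\<in>?S.
        ((\<lambda>s. h (s, snd p)) has_real_derivative h1 p) (at (fst p) within {s. (s, snd p) \<in> ?S}) \<and>
        ((\<lambda>y. h (fst p, y)) has_real_derivative h2 p) (at (snd p) within {y. (fst p, y) \<in> ?S}))"
    unfolding C_inf_on_def by blast
  then obtain gt gx where g: "gt \<in> F" "gx \<in> F" "\<forall>p\<in>?S.
        ((\<lambda>s. g (s, snd p)) has_real_derivative gt p) (at (fst p) within {s. (s, snd p) \<in> ?S}) \<and>
        ((\<lambda>y. g (fst p, y)) has_real_derivative gx p) (at (snd p) within {y. (fst p, y) \<in> ?S})"
    by blast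
  have C: "C_inf_on ?S h" if "h \<in> F" for h
    unfolding C_inf_on_def using F(2) that by blast
  show ?thesis
  proof
    show "C_inf_on ?S gt" "C_inf_on ?S gx" using C g(1,2) by auto
    fix t x :: real assume tx: "t > 0" "x \<ge> 0"
    have e: "{s. (s, x) \<in> ?S} = {0<..}" "{y. (t, y) \<in> ?S} = {0..}" using tx by auto
    have "(t, x) \<in> ?S" using tx by auto
    note d = g(3)[rule_format, OF this, unfolded fst_conv snd_conv e]
    then show
      "((\<lambda>s. g (s, x)) has_real_derivative gt (t, x)) (at t)"
      "((\<lambda>y. g (t, y)) has_real_derivative gx (t, x)) (at x within {0..})"
      using tx at_within_open[of t "{0<..}"] by simp_all
  qed
qed

lemma halfline_derivative_unique:
  fixes x :: real
  assumes "x \<ge> 0" "(f has_real_derivative a) (at x within {0..})" "(f has_real_derivative b) (at x within {0..})"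
  shows "a = b"
proof (rule vector_derivative_unique_within)
  have "at_right x \<le> at x within {0..}"
    using assms(1) by (intro at_le) auto
  then show "at x within {0..} \<noteq> bot"
    by (metis bot_unique trivial_limit_at_right_real)
qed (use assms in \<open>simp_all add: has_real_derivative_iff_has_vector_derivative\<close>)

text \<open>Symmetry has to hold at \<open>x = 0\<close> too, where only one-sided space derivatives
  exist. Hence \<open>g\<close> is recovered as a time integral of \<open>gt\<close>, differentiated
  in space under the integral sign, and then differentiated in time again.\<close>

lemma mixed_partials_halfplane:
  fixes g gt gx gtx gxt :: "real \<times> real \<Rightarrow> real"
  assumes gt: "\<And>t x. t > 0 \<Longrightarrow> x \<ge> 0 \<Longrightarrow> ((\<lambda>s. g (s, x)) has_real_derivative gt (t, x)) (at t)"
    and gx: "\<And>t x. t > 0 \<Longrightarrow> x \<ge> 0 \<Longrightarrow> ((\<lambda>y. g (t, y)) has_real_derivative gx (t, x)) (at x within {0..})"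
    and gtx: "\<And>t x. t > 0 \<Longrightarrow> x \<ge> 0 \<Longrightarrow> ((\<lambda>y. gt (t, y)) has_real_derivative gtx (t, x)) (at x within {0..})"
    and gxt: "\<And>t x. t > 0 \<Longrightarrow> x \<ge> 0 \<Longrightarrow> ((\<lambda>s. gx (s, x)) has_real_derivative gxt (t, x)) (at t)"
    and cont: "continuous_on ({0<..} \<times> {0..}) gt" "continuous_on ({0<..} \<times> {0..}) gtx"
    and tx: "t > 0" "x \<ge> 0"
  shows "gxt (t, x) = gtx (t, x)"
proof -
  \<comment> \<open>Any base time strictly between 0 and \<open>t\<close> serves: it keeps the
    integrals inside the open time domain.\<close>
  define a where "a = t / 2"
  have a: "0 < a" "a < t" using tx by (auto simp: a_def)
  have c: "continuous_on {a..r} (\<lambda>\<tau>. k (\<tau>, y))" if "continuous_on ({0<..} \<times> {0..}) k" "y \<ge> 0" for k :: "real \<times> real \<Rightarrow> real" and y r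
    by (rule continuous_on_compose2[OF that(1)]) (use a that(2) in \<open>auto intro!: continuous_intros\<close>)
  have ftc: "integral {a..r} (\<lambda>\<tau>. gt (\<tau>, y)) = g (r, y) - g (a, y)" if "r \<ge> a" "y \<ge> 0" for r y
  proof (rule integral_unique, rule fundamental_theorem_of_calculus[OF that(1)])
    fix s assume "s \<in> {a..r}"
    then show "((\<lambda>\<tau>. g (\<tau>, y)) has_vector_derivative gt (s, y)) (at s within {a..r})"
      using gt[of s y] a that
      by (auto simp: has_real_derivative_iff_has_vector_derivative intro: has_vector_derivative_at_within)
  qed
  have eq: "gx (r, x) - gx (a, x) = integral {a..r} (\<lambda>\<tau>. gtx (\<tau>, x))" if "r \<ge> a" for r
  proof (rule halfline_derivative_unique[OF tx(2)])
    show "((\<lambda>y. g (r, y) - g (a, y)) has_real_derivative gx (r, x) - gx (a, x)) (at x within {0..})"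
      using a that tx by (intro DERIV_diff gx) auto
    have "((\<lambda>y. integral (cbox a r) (\<lambda>\<tau>. gt (\<tau>, y))) has_real_derivative integral (cbox a r) (\<lambda>\<tau>. gtx (\<tau>, x))) (at x within {0..})"
    proof (rule leibniz_rule_field_derivative[where f="\<lambda>y \<tau>. gt (\<tau>, y)" and fx="\<lambda>y \<tau>. gtx (\<tau>, y)"])
      show "continuous_on ({0..} \<times> cbox a r) (\<lambda>(y, \<tau>). gtx (\<tau>, y))"
        unfolding case_prod_beta
        by (rule continuous_on_compose2[OF cont(2)]) (use a in \<open>auto intro!: continuous_intros\<close>)
      show "(\<lambda>\<tau>. gt (\<tau>, y)) integrable_on cbox a r" if "y \<in> {0..}" for y
        using c[OF cont(1), of y r] that by (simp add: integrable_continuous_real)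
    qed (use gtx a tx in auto)
    then show "((\<lambda>y. g (r, y) - g (a, y)) has_real_derivative integral {a..r} (\<lambda>\<tau>. gtx (\<tau>, x))) (at x within {0..})"
      unfolding cbox_interval
      by (rule has_field_derivative_transform_within[OF _ zero_less_one]) (use tx ftc[OF that] in auto)
  qed
  have "((\<lambda>r. integral {a..r} (\<lambda>\<tau>. gtx (\<tau>, x))) has_real_derivative gtx (t, x)) (at t within {a..t+1})"
    by (rule integral_has_real_derivative[OF c[OF cont(2) tx(2)]]) (use a in auto)
  then have "((\<lambda>r. integral {a..r} (\<lambda>\<tau>. gtx (\<tau>, x))) has_real_derivative gtx (t, x)) (at t)"
    using a at_within_interior[of t "{a..t+1}"] by simp
  moreover have "((\<lambda>r. integral {a..r} (\<lambda>\<tau>. gtx (\<tau>, x))) has_real_derivative gxt (t, x)) (at t)"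
  proof (rule has_field_derivative_transform_within[where S=UNIV and f="\<lambda>r. gx (r, x) - gx (a, x)"])
    show "((\<lambda>r. gx (r, x) - gx (a, x)) has_real_derivative gxt (t, x)) (at t)"
      using DERIV_diff[OF gxt[OF tx] DERIV_const] by simp
    show "0 < t - a" using a by simp
    show "gx (r, x) - gx (a, x) = integral {a..r} (\<lambda>\<tau>. gtx (\<tau>, x))" if "dist r t < t - a" for r
      using that eq[of r] by (auto simp: dist_real_def)
  qed auto
  ultimately show ?thesis by (rule DERIV_unique[symmetric])
qed

text \<open>On a compact rectangle away from \<open>t = 0\<close> all derivatives are bounded, so
  \<open>robin_step_taylor\<close> in space and a first-order expansion in time give the same
  generator by the equation. Truncation with \<open>max 0\<close> extends the slice of
  \<open>v\<close> to the whole line without changing what the chain sees.\<close>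

lemma robin_step_consistency:
  fixes v v1 v2 v3 vt vtt :: "real \<times> real \<Rightarrow> real" and c \<mu> \<epsilon> T \<delta> R C0 :: real
  assumes cont: "continuous_on ({0<..} \<times> {0..}) v" "continuous_on ({0<..} \<times> {0..}) v1"
      "continuous_on ({0<..} \<times> {0..}) v2" "continuous_on ({0<..} \<times> {0..}) v3" "continuous_on ({0<..} \<times> {0..}) vtt"
    and v1: "\<And>t x. t > 0 \<Longrightarrow> x \<ge> 0 \<Longrightarrow> ((\<lambda>y. v (t, y)) has_real_derivative v1 (t, x)) (at x within {0..})"
    and v2: "\<And>t x. t > 0 \<Longrightarrow> x \<ge> 0 \<Longrightarrow> ((\<lambda>y. v1 (t, y)) has_real_derivative v2 (t, x)) (at x within {0..})"
    and v3: "\<And>t x. t > 0 \<Longrightarrow> x \<ge> 0 \<Longrightarrow> ((\<lambda>y. v2 (t, y)) has_real_derivative v3 (t, x)) (at x within {0..})"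
    and vt: "\<And>t x. t > 0 \<Longrightarrow> x \<ge> 0 \<Longrightarrow> ((\<lambda>s. v (s, x)) has_real_derivative vt (t, x)) (at t)"
    and vtt: "\<And>t x. t > 0 \<Longrightarrow> x \<ge> 0 \<Longrightarrow> ((\<lambda>s. vt (s, x)) has_real_derivative vtt (t, x)) (at t)"
    and pde: "\<And>t x. t > 0 \<Longrightarrow> x \<ge> 0 \<Longrightarrow> vt (t, x) = \<mu> * v1 (t, x) + v2 (t, x) / 2"
    and robin: "\<And>t. t > 0 \<Longrightarrow> v1 (t, 0) = c * v (t, 0)"
    and C0: "\<And>t x. \<epsilon> \<le> t \<Longrightarrow> t \<le> T \<Longrightarrow> x \<ge> 0 \<Longrightarrow> \<bar>v (t, x)\<bar> \<le> C0"
    and \<epsilon>: "\<epsilon> > 0" and \<delta>: "\<delta> > 0"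
  obtains h0 where "h0 > 0" "\<And>h \<tau> y. 0 < h \<Longrightarrow> h < h0 \<Longrightarrow> \<epsilon> \<le> \<tau> \<Longrightarrow> \<tau> + h \<le> T \<Longrightarrow> 0 \<le> y \<Longrightarrow> y \<le> R \<Longrightarrow>
     \<bar>robin_step c \<mu> h (\<lambda>z. v (\<tau>, max 0 z)) y - v (\<tau> + h, y)\<bar> \<le> \<delta> * h + \<delta> * (\<integral>s. max 0 (s - \<mu> * h - y) \<partial>gauss h)"
proof -
  let ?S = "{0<..} \<times> {0..} :: (real \<times> real) set"
  \<comment> \<open>The margin 1 accommodates the increments of modulus at most 1, the only ones
    that are expanded.\<close>
  define K where "K = {\<epsilon>..T} \<times> {0..R+1}"
  have K: "compact K" "K \<subseteq> ?S" unfolding K_def using \<epsilon> by (auto intro!: compact_Times)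
  have bd: "\<exists>B. \<forall>p\<in>K. \<bar>k p\<bar> \<le> B" if "continuous_on ?S k" for k :: "real \<times> real \<Rightarrow> real"
    using compact_imp_bounded[OF compact_continuous_image[OF continuous_on_subset[OF that K(2)] K(1)]]
    unfolding bounded_iff by auto
  obtain B1 where B1: "\<forall>p\<in>K. \<bar>v1 p\<bar> \<le> B1" using bd[OF cont(2)] by blast
  obtain B2 where B2: "\<forall>p\<in>K. \<bar>v2 p\<bar> \<le> B2" using bd[OF cont(3)] by blast
  obtain B3 where B3: "\<forall>p\<in>K. \<bar>v3 p\<bar> \<le> B3" using bd[OF cont(4)] by blast
  obtain Bt where Bt: "\<forall>p\<in>K. \<bar>vtt p\<bar> \<le> Bt" using bd[OF cont(5)] by blast
  note B = B1 B2 B3 Bt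
  define C where "C = 1 + \<bar>C0\<bar> + \<bar>B1\<bar> + \<bar>B2\<bar> + \<bar>B3\<bar> + \<bar>Bt\<bar>"
  have CB: "1 \<le> C" "C0 \<le> C" "B1 \<le> C" "B2 \<le> C" "B3 \<le> C" "Bt \<le> C"
    unfolding C_def by simp_all
  define D where "D = c\<^sup>2 * exp \<bar>c\<bar> + 1"
  define G where "G = 54 * exp ((1 + \<bar>c\<bar>) * \<bar>\<mu>\<bar> + (1 + \<bar>c\<bar>)\<^sup>2 / 2)"
  have D: "D \<ge> 1" by (simp add: D_def)
  have G: "G \<ge> 0" by (simp add: G_def)
  \<comment> \<open>Makes the coefficient \<open>C * D * \<theta>\<close> of the expected overshoot
    equal to \<delta>. The large constant \<open>D / \<theta>\<close> that results is paid for by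
    \<open>h0\<close>.\<close>
  define \<theta> where "\<theta> = \<delta> / (C * D)"
  have \<theta>: "\<theta> > 0" using \<delta> CB(1) D by (simp add: \<theta>_def)
  define A where "A = C * (4 + D / \<theta>) * G + C * \<mu>\<^sup>2 + C"
  have A: "A > 0" unfolding A_def using CB(1) D G \<theta> by (intro add_nonneg_pos add_nonneg_nonneg mult_nonneg_nonneg) auto
  \<comment> \<open>Below \<open>h0\<close> one has sqrt h \<le> \<delta> / A, so errors of order
    \<open>A * (h * sqrt h)\<close> are at most \<open>\<delta> * h\<close>; h \<le> 1 reduces h^2
    to h sqrt h.\<close>
  define h0 where "h0 = min 1 ((\<delta> / A)\<^sup>2)"
  show ?thesis
  proof
    show "h0 > 0" using \<delta> A by (simp add: h0_def)
    fix h \<tau> y assume h: "0 < h" "h < h0" and \<tau>: "\<epsilon> \<le> \<tau>" "\<tau> + h \<le> T" and y: "0 \<le> y" "y \<le> R"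
    let ?E = "\<integral>s. max 0 (s - \<mu> * h - y) \<partial>gauss h"
    have h1: "h \<le> 1" using h by (simp add: h0_def)
    have \<tau>0: "\<tau> > 0" using \<tau> \<epsilon> by simp
    have dw: "(p has_real_derivative q z) (at z within {0..R+1})"
      if "\<And>z. z \<ge> 0 \<Longrightarrow> (p has_real_derivative q z) (at z within {0..})" "z \<in> {0..R+1}" for p q z
      by (rule DERIV_subset[OF that(1)]) (use that(2) in auto)
    have step: "\<bar>robin_step c \<mu> h (\<lambda>z. v (\<tau>, max 0 z)) y - (v (\<tau>, max 0 y) + h * (\<mu> * v1 (\<tau>, y) + v2 (\<tau>, y) / 2))\<bar>
      \<le> C * (4 + D / \<theta>) * G * (h * sqrt h) + C * \<mu>\<^sup>2 * h\<^sup>2 + C * D * \<theta> * ?E"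
      unfolding D_def G_def
    proof (rule robin_step_taylor[where R=R and ?p1.0="\<lambda>z. v1 (\<tau>, z)" and ?p2.0="\<lambda>z. v2 (\<tau>, z)" and ?p3.0="\<lambda>z. v3 (\<tau>, z)"])
      show "((\<lambda>z. v (\<tau>, max 0 z)) has_real_derivative v1 (\<tau>, z)) (at z within {0..R+1})" if "z \<in> {0..R+1}" for z
        by (rule has_field_derivative_transform_within[OF dw[of "\<lambda>z. v (\<tau>, z)" "\<lambda>z. v1 (\<tau>, z)"] zero_less_one])
           (use v1 \<tau>0 that in auto)
      show "((\<lambda>z. v1 (\<tau>, z)) has_real_derivative v2 (\<tau>, z)) (at z within {0..R+1})" if "z \<in> {0..R+1}" for z
        by (rule dw) (use v2 \<tau>0 that in auto)
      show "((\<lambda>z. v2 (\<tau>, z)) has_real_derivative v3 (\<tau>, z)) (at z within {0..R+1})" if "z \<in> {0..R+1}" for z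
        by (rule dw) (use v3 \<tau>0 that in auto)
      show "\<bar>v1 (\<tau>, z)\<bar> \<le> C" "\<bar>v2 (\<tau>, z)\<bar> \<le> C" "\<bar>v3 (\<tau>, z)\<bar> \<le> C" if "z \<in> {0..R+1}" for z
      proof -
        have "(\<tau>, z) \<in> K" using \<tau> h that by (auto simp: K_def)
        then show "\<bar>v1 (\<tau>, z)\<bar> \<le> C" "\<bar>v2 (\<tau>, z)\<bar> \<le> C" "\<bar>v3 (\<tau>, z)\<bar> \<le> C"
          using B(1-3) CB(3-5) order_trans by blast+
      qed
      show "\<bar>v (\<tau>, max 0 z)\<bar> \<le> C" for z
        using C0[of \<tau> "max 0 z"] CB \<tau> h by auto
      show "(\<lambda>z. v (\<tau>, max 0 z)) \<in> borel_measurable borel"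
        by (intro borel_measurable_continuous_onI continuous_on_compose2[OF cont(1)]) (use \<tau>0 in \<open>auto intro!: continuous_intros\<close>)
    qed (use robin y h h1 \<theta> \<tau>0 in auto)
    have time: "\<bar>v (\<tau> + h, y) - (v (\<tau>, y) + h * vt (\<tau>, y))\<bar> \<le> C * h\<^sup>2"
    proof -
      have "norm ((\<lambda>i s. ([v,vt,vtt] ! i) (s, y)) 0 (\<tau> + h) - (\<Sum>i\<le>1. ([v,vt,vtt] ! i) (\<tau>, y) * ((\<tau> + h) - \<tau>) ^ i / fact i))
        \<le> C * norm ((\<tau> + h) - \<tau>) ^ Suc 1 / fact 1"
      proof (rule field_Taylor[where S="{\<epsilon>..T}"])
        fix i s assume i: "s \<in> {\<epsilon>..T}" "i \<le> (1::nat)"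
        have "((\<lambda>s. v (s, y)) has_real_derivative vt (s, y)) (at s within {\<epsilon>..T})"
          "((\<lambda>s. vt (s, y)) has_real_derivative vtt (s, y)) (at s within {\<epsilon>..T})"
          using vt[of s y] vtt[of s y] i \<epsilon> y by (auto intro: has_field_derivative_at_within)
        then show "((\<lambda>s. ([v,vt,vtt] ! i) (s, y)) has_field_derivative ([v,vt,vtt] ! Suc i) (s, y)) (at s within {\<epsilon>..T})"
          using i by (auto simp: le_Suc_eq)
      next
        show "norm (([v,vt,vtt] ! Suc 1) (s, y)) \<le> C" if "s \<in> {\<epsilon>..T}" for s
        proof -
          have "(s, y) \<in> K" using that y by (auto simp: K_def)
          then have "\<bar>vtt (s, y)\<bar> \<le> C" using B(4) CB(6) order_trans by blast
          then show ?thesis by simp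
        qed
      qed (use \<tau> h in auto)
      then show ?thesis by (simp add: power2_eq_square algebra_simps)
    qed
    have hs: "h * sqrt h \<le> h * (\<delta> / A)"
      using h A \<delta> by (intro mult_left_mono real_le_lsqrt) (auto simp: h0_def)
    have h2: "h\<^sup>2 \<le> h * sqrt h"
    proof -
      have "sqrt h * sqrt h \<le> sqrt h" using h h1 by (intro mult_left_le) auto
      then have "h \<le> sqrt h" using h by simp
      then show ?thesis using h by (simp add: power2_eq_square)
    qed
    have "C * (4 + D / \<theta>) * G * (h * sqrt h) + C * \<mu>\<^sup>2 * h\<^sup>2 + C * h\<^sup>2 \<le> A * (h * sqrt h)"
    proof -
      have "C * \<mu>\<^sup>2 * h\<^sup>2 \<le> C * \<mu>\<^sup>2 * (h * sqrt h)" "C * h\<^sup>2 \<le> C * (h * sqrt h)"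
        using h2 CB(1) by (intro mult_left_mono; simp)+
      then show ?thesis unfolding A_def by (simp only: distrib_right)
    qed
    also have "\<dots> \<le> A * (h * (\<delta> / A))" using A by (intro mult_left_mono[OF hs]) auto
    also have "\<dots> = \<delta> * h" using A by simp
    finally have sm: "C * (4 + D / \<theta>) * G * (h * sqrt h) + C * \<mu>\<^sup>2 * h\<^sup>2 + C * h\<^sup>2 \<le> \<delta> * h" .
    have "C * D * \<theta> = \<delta>" using CB(1) D by (simp add: \<theta>_def)
    with step sm time have 1: "\<bar>robin_step c \<mu> h (\<lambda>z. v (\<tau>, max 0 z)) y - (v (\<tau>, y) + h * vt (\<tau>, y))\<bar>
      \<le> C * (4 + D / \<theta>) * G * (h * sqrt h) + C * \<mu>\<^sup>2 * h\<^sup>2 + \<delta> * ?E"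
      using y \<tau>0 by (simp add: pde)
    have tri: "\<bar>x1 - x2\<bar> \<le> a + b" if "\<bar>x1 - x3\<bar> \<le> a" "\<bar>x2 - x3\<bar> \<le> b" for x1 x2 x3 a b :: real
      using that by linarith
    show "\<bar>robin_step c \<mu> h (\<lambda>z. v (\<tau>, max 0 z)) y - v (\<tau> + h, y)\<bar> \<le> \<delta> * h + \<delta> * ?E"
      using tri[OF 1 time] sm by linarith
  qed
qed

lemma robin_step_iterates_tendsto:
  fixes v v1 v2 v3 vt vtt :: "real \<times> real \<Rightarrow> real" and c \<mu> \<epsilon> t C0 x :: real
  assumes cont: "continuous_on ({0<..} \<times> {0..}) v" "continuous_on ({0<..} \<times> {0..}) v1"
      "continuous_on ({0<..} \<times> {0..}) v2" "continuous_on ({0<..} \<times> {0..}) v3" "continuous_on ({0<..} \<times> {0..}) vtt"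
    and v1: "\<And>t x. t > 0 \<Longrightarrow> x \<ge> 0 \<Longrightarrow> ((\<lambda>y. v (t, y)) has_real_derivative v1 (t, x)) (at x within {0..})"
    and v2: "\<And>t x. t > 0 \<Longrightarrow> x \<ge> 0 \<Longrightarrow> ((\<lambda>y. v1 (t, y)) has_real_derivative v2 (t, x)) (at x within {0..})"
    and v3: "\<And>t x. t > 0 \<Longrightarrow> x \<ge> 0 \<Longrightarrow> ((\<lambda>y. v2 (t, y)) has_real_derivative v3 (t, x)) (at x within {0..})"
    and vt: "\<And>t x. t > 0 \<Longrightarrow> x \<ge> 0 \<Longrightarrow> ((\<lambda>s. v (s, x)) has_real_derivative vt (t, x)) (at t)"
    and vtt: "\<And>t x. t > 0 \<Longrightarrow> x \<ge> 0 \<Longrightarrow> ((\<lambda>s. vt (s, x)) has_real_derivative vtt (t, x)) (at t)"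
    and pde: "\<And>t x. t > 0 \<Longrightarrow> x \<ge> 0 \<Longrightarrow> vt (t, x) = \<mu> * v1 (t, x) + v2 (t, x) / 2"
    and robin: "\<And>t. t > 0 \<Longrightarrow> v1 (t, 0) = c * v (t, 0)"
    and C0: "\<And>s x. \<epsilon> \<le> s \<Longrightarrow> s \<le> \<epsilon> + t \<Longrightarrow> x \<ge> 0 \<Longrightarrow> \<bar>v (s, x)\<bar> \<le> C0"
    and \<epsilon>: "\<epsilon> > 0" and t: "t > 0" and x: "x \<ge> 0"
  shows "(\<lambda>n. (robin_step c \<mu> (t / n) ^^ n) (\<lambda>z. v (\<epsilon>, max 0 z)) x) \<longlonglongrightarrow> v (\<epsilon> + t, x)"
proof (rule LIMSEQ_I)
  fix e :: real assume e: "e > 0"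
  define L where "L = barrier_rate c \<mu>"
  define P where "P = exp ((L + 1) * t) * barrier c 1 x"
  have P: "P > 0" using barrier_ge(2)[of c 1 x] by (simp add: P_def)
  \<comment> \<open>The tolerances are fixed in the order \<delta>, \<open>R\<close>,
    \<open>h0\<close>. The comparison at time \<open>t\<close> yields the error
    \<open>\<delta> * P\<close>, that is, half of \<open>e\<close>.\<close>
  define \<delta> where "\<delta> = e / 2 / P"
  have \<delta>: "\<delta> > 0" using e P by (simp add: \<delta>_def)
  have C0n: "C0 \<ge> 0" using C0[of \<epsilon> 0] t by linarith
  \<comment> \<open>With cosh R \<ge> R / 2 this puts the crude bound on both functions below
    \<open>\<delta> * cosh R\<close>.\<close>
  define R where "R = 2 * (C0 * (1 + 2 * exp (L * t))) / \<delta>"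
  have R: "R \<ge> 0" using C0n \<delta> by (simp add: R_def add_nonneg_nonneg)
  have "exp (- R) > 0" by simp
  with exp_ge_add_one_self[of R] have "R \<le> exp R + exp (- R)" by linarith
  then have "R / 2 \<le> cosh R" by (simp add: cosh_def)
  then have "\<delta> * (R / 2) \<le> \<delta> * cosh R" using \<delta> by (intro mult_left_mono) auto
  then have R2: "C0 * (1 + 2 * exp (L * t)) \<le> \<delta> * cosh R" using \<delta> by (simp add: R_def)
  obtain h0 where h0: "h0 > 0" "\<And>h \<tau> y. 0 < h \<Longrightarrow> h < h0 \<Longrightarrow> \<epsilon> \<le> \<tau> \<Longrightarrow> \<tau> + h \<le> \<epsilon> + t \<Longrightarrow> 0 \<le> y \<Longrightarrow> y \<le> R \<Longrightarrow>
     \<bar>robin_step c \<mu> h (\<lambda>z. v (\<tau>, max 0 z)) y - v (\<tau> + h, y)\<bar> \<le> \<delta> * h + \<delta> * (\<integral>s. max 0 (s - \<mu> * h - y) \<partial>gauss h)"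
    by (rule robin_step_consistency[OF cont v1 v2 v3 vt vtt pde robin C0 \<epsilon> \<delta>, of "\<epsilon> + t" R]) (auto simp: add.commute)
  obtain N :: nat where N: "t / h0 < N" using reals_Archimedean2 by blast
  show "\<exists>N. \<forall>n\<ge>N. norm ((robin_step c \<mu> (t / n) ^^ n) (\<lambda>z. v (\<epsilon>, max 0 z)) x - v (\<epsilon> + t, x)) < e"
  proof (intro exI[of _ N] allI impI)
    fix n :: nat assume "n \<ge> N"
    then have n: "t / h0 < n" using N by linarith
    then have n0: "n > 0" using t h0(1) by (metis divide_pos_pos less_trans of_nat_0_less_iff)
    define h where "h = t / n"
    have h: "0 < h" "h < h0" "n * h = t" using n n0 t h0(1) by (auto simp: h_def field_simps)
    define w where "w = (\<lambda>k z. v (\<epsilon> + real k * h, max 0 z))"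
    have kh: "real k * h \<le> t" if "k \<le> n" for k
      using that h by (metis h(3) less_imp_le mult_right_mono of_nat_le_iff)
    have "\<bar>(robin_step c \<mu> h ^^ n) (w 0) x - w n x\<bar> \<le> \<delta> * exp ((L + 1) * (n * h)) * barrier c 1 x"
      unfolding L_def
    proof (rule robin_step_comparison[OF h(1) \<delta>, where C=C0 and R=R and n=n])
      fix k assume k: "k \<le> n"
      show "w k \<in> borel_measurable borel"
        unfolding w_def
        by (intro borel_measurable_continuous_onI continuous_on_compose2[OF cont(1)])
           (use \<epsilon> h in \<open>auto intro!: continuous_intros add_pos_nonneg\<close>)
      show "\<bar>w k z\<bar> \<le> C0" for z
        unfolding w_def using kh[OF k] h by (intro C0) auto
    next
      fix k y assume k: "k < n" and y: "0 \<le> y" "y \<le> R"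
      have "real (Suc k) * h \<le> t" using k by (intro kh) auto
      then have "\<epsilon> + real k * h + h \<le> \<epsilon> + t" by (simp add: algebra_simps)
      from h0(2)[OF h(1,2) _ this y] h y
      show "\<bar>robin_step c \<mu> h (w k) y - w (Suc k) y\<bar> \<le> \<delta> * h + \<delta> * (\<integral>s. max 0 (s - \<mu> * h - y) \<partial>gauss h)"
        by (simp add: w_def algebra_simps)
    qed (use R R2 x h in \<open>auto simp: L_def\<close>)
    also have "\<dots> = \<delta> * P" by (simp add: P_def h)
    also have "\<dots> < e" using P e by (simp add: \<delta>_def)
    finally show "norm ((robin_step c \<mu> (t / n) ^^ n) (\<lambda>z. v (\<epsilon>, max 0 z)) x - v (\<epsilon> + t, x)) < e"
      using h x by (simp add: w_def h_def)
  qed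
qed

subsection \<open>The chain on a Brownian grid\<close>

text \<open>The starting level \<open>x\<close> stands in the place of \<open>s 0\<close>. For a
  path with \<open>s 0 = 0\<close> and \<open>x \<ge> 0\<close> the result is the maximum of
  \<open>x\<close> and all values up to index \<open>n\<close>.\<close>

primrec running_max :: "real \<Rightarrow> (nat \<Rightarrow> real) \<Rightarrow> nat \<Rightarrow> real" where
  "running_max x s 0 = x"
| "running_max x s (Suc n) = max (running_max x s n) (s (Suc n))"

lemma running_max_ge: "x \<le> running_max x s n"
  by (induction n) auto

lemma running_max_ge_nth: "k \<le> n \<Longrightarrow> 0 < k \<Longrightarrow> s k \<le> running_max x s n"
  by (induction n) (auto simp: le_Suc_eq le_max_iff_disj)

lemma running_max_le: "x \<le> C \<Longrightarrow> (\<And>k. k \<le> n \<Longrightarrow> s k \<le> C) \<Longrightarrow> running_max x s n \<le> C"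
  by (induction n) auto

lemma running_max_cong: "(\<And>k. k \<le> n \<Longrightarrow> s k = s' k) \<Longrightarrow> running_max x s n = running_max x s' n"
  by (induction n) auto

definition drift_walk :: "real \<Rightarrow> real \<Rightarrow> (nat \<Rightarrow> real) \<Rightarrow> nat \<Rightarrow> real" where
  "drift_walk \<mu> h \<xi> k = (\<Sum>i<k. \<xi> i - \<mu> * h)"

lemma running_max_drift_walk_measurable [measurable]:
  assumes "k \<le> n"
  shows "(\<lambda>\<xi>. drift_walk \<mu> h \<xi> k) \<in> borel_measurable (PiM {..<n} (\<lambda>_. gauss h))"
    and "(\<lambda>\<xi>. running_max x (drift_walk \<mu> h \<xi>) k) \<in> borel_measurable (PiM {..<n} (\<lambda>_. gauss h))"
proof -
  have comp: "(\<lambda>\<xi>. \<xi> i) \<in> borel_measurable (PiM {..<n} (\<lambda>_. gauss h))" if "i < n" for i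
    using measurable_component_singleton[of i "{..<n}" "\<lambda>_. gauss h"] that
    by (simp add: measurable_cong_sets[OF refl sets_gauss])
  have w: "(\<lambda>\<xi>. drift_walk \<mu> h \<xi> k) \<in> borel_measurable (PiM {..<n} (\<lambda>_. gauss h))" if "k \<le> n" for k
    unfolding drift_walk_def using that comp by (intro borel_measurable_sum borel_measurable_diff) auto
  show "(\<lambda>\<xi>. running_max x (drift_walk \<mu> h \<xi>) k) \<in> borel_measurable (PiM {..<n} (\<lambda>_. gauss h))"
    using assms by (induction k) (auto intro!: borel_measurable_max w)
  show "(\<lambda>\<xi>. drift_walk \<mu> h \<xi> k) \<in> borel_measurable (PiM {..<n} (\<lambda>_. gauss h))"
    using w assms .
qed

lemma running_max_drift_walk_bound:
  assumes "x \<ge> 0"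
  shows "running_max x (drift_walk \<mu> h \<xi>) n - x \<le> (\<Sum>i<n. \<bar>\<xi> i - \<mu> * h\<bar>)"
proof -
  have "drift_walk \<mu> h \<xi> k \<le> x + (\<Sum>i<n. \<bar>\<xi> i - \<mu> * h\<bar>)" if "k \<le> n" for k
  proof -
    have "drift_walk \<mu> h \<xi> k \<le> (\<Sum>i<k. \<bar>\<xi> i - \<mu> * h\<bar>)"
      unfolding drift_walk_def by (intro sum_mono) auto
    also have "\<dots> \<le> (\<Sum>i<n. \<bar>\<xi> i - \<mu> * h\<bar>)"
      using that by (intro sum_mono2) auto
    finally show ?thesis using assms by simp
  qed
  then have "running_max x (drift_walk \<mu> h \<xi>) n \<le> x + (\<Sum>i<n. \<bar>\<xi> i - \<mu> * h\<bar>)"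
    by (intro running_max_le) (auto simp: sum_nonneg)
  then show ?thesis by simp
qed

definition reflected_weight :: "real \<Rightarrow> real \<Rightarrow> (nat \<Rightarrow> real) \<Rightarrow> nat \<Rightarrow> (real \<Rightarrow> real) \<Rightarrow> real" where
  "reflected_weight c x s n g = g (running_max x s n - s n) * exp (- c * (running_max x s n - x))"

lemma drift_walk_le_running_max:
  assumes "x \<ge> 0"
  shows "drift_walk \<mu> h \<xi> n \<le> running_max x (drift_walk \<mu> h \<xi>) n"
  using assms running_max_ge_nth[of n n "drift_walk \<mu> h \<xi>" x] by (cases n) (auto simp: drift_walk_def)

text \<open>Integrating out the last increment replaces the terminal function \<open>g\<close> by
  \<open>robin_step c \<mu> h g\<close> and shortens the walk by one. The induction therefore runs
  over all bounded measurable \<open>g\<close>, with a bound that changes from step to step.\<close>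

lemma reflected_weight_expectation:
  fixes x c \<mu> h C :: real
  assumes h: "h > 0" and x: "x \<ge> 0" and g: "g \<in> borel_measurable borel" "\<And>z. z \<ge> 0 \<Longrightarrow> \<bar>g z\<bar> \<le> C"
  shows "integrable (PiM {..<n} (\<lambda>_. gauss h)) (\<lambda>\<xi>. reflected_weight c x (drift_walk \<mu> h \<xi>) n g)"
    and "(\<integral>\<xi>. reflected_weight c x (drift_walk \<mu> h \<xi>) n g \<partial>PiM {..<n} (\<lambda>_. gauss h)) = (robin_step c \<mu> h ^^ n) g x"
proof -
  interpret G: prob_space "gauss h" by (rule prob_space_gauss[OF h])
  interpret product_prob_space "\<lambda>_::nat. gauss h" by unfold_locales
  have int: "integrable (PiM {..<n} (\<lambda>_. gauss h)) (\<lambda>\<xi>. reflected_weight c x (drift_walk \<mu> h \<xi>) n g)"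
    if g: "g \<in> borel_measurable borel" "\<And>z. z \<ge> 0 \<Longrightarrow> \<bar>g z\<bar> \<le> C" for g C n
  proof -
    have C: "C \<ge> 0" using g(2)[of 0] by linarith
    have [measurable]: "g \<in> borel_measurable borel" by fact
    \<comment> \<open>The local time is at most the sum of the moduli of the increments, so the
      weight is dominated by a product of functions of single coordinates.\<close>
    have i: "integrable (PiM {..<n} (\<lambda>_. gauss h)) (\<lambda>\<xi>. C * (\<Prod>i<n. exp (\<bar>c\<bar> * \<bar>\<xi> i - \<mu> * h\<bar>)))"
      by (intro integrable_mult_right product_integrable_prod gauss_exp_drift h) auto
    have "\<bar>reflected_weight c x (drift_walk \<mu> h \<xi>) n g\<bar> \<le> C * (\<Prod>i<n. exp (\<bar>c\<bar> * \<bar>\<xi> i - \<mu> * h\<bar>))" for \<xi>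
    proof -
      let ?L = "running_max x (drift_walk \<mu> h \<xi>) n - x"
      have "- c * ?L \<le> \<bar>c\<bar> * ?L" using running_max_ge[of x "drift_walk \<mu> h \<xi>" n] by (intro mult_right_mono) auto
      also have "\<dots> \<le> \<bar>c\<bar> * (\<Sum>i<n. \<bar>\<xi> i - \<mu> * h\<bar>)"
        by (intro mult_left_mono running_max_drift_walk_bound x) auto
      finally have "exp (- c * ?L) \<le> (\<Prod>i<n. exp (\<bar>c\<bar> * \<bar>\<xi> i - \<mu> * h\<bar>))"
        by (simp add: exp_sum[symmetric] sum_distrib_left)
      then show ?thesis
        unfolding reflected_weight_def abs_mult abs_exp_cancel
        using C drift_walk_le_running_max[OF x, of \<mu> h \<xi> n] by (intro mult_mono g(2)) auto
    qed
    then show ?thesis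
      by (intro Bochner_Integration.integrable_bound[OF i] AE_I2) (simp_all add: reflected_weight_def order_trans[OF _ abs_ge_self])
  qed
  show "integrable (PiM {..<n} (\<lambda>_. gauss h)) (\<lambda>\<xi>. reflected_weight c x (drift_walk \<mu> h \<xi>) n g)"
    using int g by blast
  show "(\<integral>\<xi>. reflected_weight c x (drift_walk \<mu> h \<xi>) n g \<partial>PiM {..<n} (\<lambda>_. gauss h)) = (robin_step c \<mu> h ^^ n) g x"
    using g
  proof (induction n arbitrary: g C)
    case 0
    show ?case by (simp add: reflected_weight_def drift_walk_def PiM_empty lebesgue_integral_count_space_finite)
  next
    case (Suc n)
    let ?P = "PiM {..<n} (\<lambda>_::nat. gauss h)"
    note m = Suc.prems
    have "(\<integral>\<xi>. reflected_weight c x (drift_walk \<mu> h \<xi>) (Suc n) g \<partial>PiM {..<Suc n} (\<lambda>_. gauss h))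
      = (\<integral>\<xi>. (\<integral>s. reflected_weight c x (drift_walk \<mu> h (\<xi>(n := s))) (Suc n) g \<partial>gauss h) \<partial>?P)"
      unfolding lessThan_Suc
      by (rule product_integral_insert) (use int[OF m, of "Suc n"] in \<open>auto simp: lessThan_Suc\<close>)
    also have "\<dots> = (\<integral>\<xi>. reflected_weight c x (drift_walk \<mu> h \<xi>) n (robin_step c \<mu> h g) \<partial>?P)"
    proof (rule Bochner_Integration.integral_cong[OF refl])
      fix \<xi>
      let ?W = "drift_walk \<mu> h \<xi>"
      let ?R = "running_max x ?W n"
      have w: "drift_walk \<mu> h (\<xi>(n := s)) k = ?W k" if "k \<le> n" for s k
        unfolding drift_walk_def using that by (intro sum.cong) auto
      have w': "drift_walk \<mu> h (\<xi>(n := s)) (Suc n) = ?W n + (s - \<mu> * h)" for s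
        using w[of n s] by (simp add: drift_walk_def)
      have r: "running_max x (drift_walk \<mu> h (\<xi>(n := s))) n = ?R" for s
        by (intro running_max_cong w)
      have "reflected_weight c x (drift_walk \<mu> h (\<xi>(n := s))) (Suc n) g
        = g (max 0 (?R - ?W n - (s - \<mu> * h))) * exp (- c * max 0 (s - \<mu> * h - (?R - ?W n))) * exp (- c * (?R - x))" for s
      proof -
        \<comment> \<open>The Lindley recursion: written through the reflected position
          \<open>?R - ?W n\<close>, position and local time after the step depend on the past only
          through their current values.\<close>
        have 1: "max ?R (?W n + (s - \<mu> * h)) - (?W n + (s - \<mu> * h)) = max 0 (?R - ?W n - (s - \<mu> * h))"
          "max ?R (?W n + (s - \<mu> * h)) - x = max 0 (s - \<mu> * h - (?R - ?W n)) + (?R - x)"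
          by auto
        show ?thesis
          unfolding reflected_weight_def running_max.simps r w' 1 distrib_left exp_add by simp
      qed
      then show "(\<integral>s. reflected_weight c x (drift_walk \<mu> h (\<xi>(n := s))) (Suc n) g \<partial>gauss h)
        = reflected_weight c x ?W n (robin_step c \<mu> h g)"
        by (simp add: reflected_weight_def robin_step_def)
    qed
    also have "\<dots> = (robin_step c \<mu> h ^^ n) (robin_step c \<mu> h g) x"
    proof (rule Suc.IH)
      show "robin_step c \<mu> h g \<in> borel_measurable borel"
        using h m(1) by (rule robin_step_measurable)
      show "z \<ge> 0 \<Longrightarrow> \<bar>robin_step c \<mu> h g z\<bar> \<le> 2 * C * exp (barrier_rate c \<mu> * (real 1 * h))" for z
        using robin_step_funpow_bounds(2)[OF h m, where y=z and c=c and \<mu>=\<mu> and k=1] by simp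
    qed
    also have "\<dots> = (robin_step c \<mu> h ^^ Suc n) g x" by (simp add: funpow_swap1)
    finally show ?case .
  qed
qed

lemma brownian_grid_distr:
  assumes BM: "std_brownian_motion M B" and h: "h > 0" and n: "n > 0"
  shows "distr M (PiM {..<n} (\<lambda>_. gauss h)) (\<lambda>\<omega>. \<lambda>i\<in>{..<n}. B (real (Suc i) * h) \<omega> - B (real i * h) \<omega>)
    = PiM {..<n} (\<lambda>_. gauss h)"
    and "(\<lambda>\<omega>. \<lambda>i\<in>{..<n}. B (real (Suc i) * h) \<omega> - B (real i * h) \<omega>) \<in> M \<rightarrow>\<^sub>M PiM {..<n} (\<lambda>_. gauss h)"
proof -
  interpret prob_space M using BM by (simp add: std_brownian_motion_def)
  define X where "X = (\<lambda>(i::nat) \<omega>. B (real (Suc i) * h) \<omega> - B (real i * h) \<omega>)"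
  have Bm: "B s \<in> borel_measurable M" if "s \<ge> 0" for s
    using BM that by (simp add: std_brownian_motion_def)
  have Xm: "X i \<in> borel_measurable M" for i
    unfolding X_def using h by (intro borel_measurable_diff Bm) auto
  have indep: "prob_space.indep_vars M (\<lambda>_. borel) X {..<n}"
  proof -
    have "\<forall>(n::nat) (ts::nat \<Rightarrow> real). 0 \<le> ts 0 \<and> (\<forall>i<n. ts i < ts (Suc i)) \<longrightarrow>
        prob_space.indep_vars M (\<lambda>_. borel) (\<lambda>i \<omega>. B (ts (Suc i)) \<omega> - B (ts i) \<omega>) {..<n}"
      using BM by (simp add: std_brownian_motion_def)
    from this[rule_format, of "\<lambda>i. real i * h" n] show ?thesis
      unfolding X_def using h by simp
  qed
  have d: "distr M borel (X i) = gauss h" for i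
  proof -
    have "\<forall>s t. 0 \<le> s \<and> s < t \<longrightarrow>
        distributed M lborel (\<lambda>\<omega>. B t \<omega> - B s \<omega>) (\<lambda>y. ennreal (normal_density 0 (sqrt (t - s)) y))"
      using BM by (simp add: std_brownian_motion_def)
    from this[rule_format, of "real i * h" "real (Suc i) * h"]
    have "distributed M lborel (X i) (\<lambda>y. ennreal (normal_density 0 (sqrt h) y))"
      using h by (simp add: X_def algebra_simps)
    from distributed_distr_eq_density[OF this]
    show ?thesis by (simp add: gauss_def cong: distr_cong)
  qed
  have "distr M (PiM {..<n} (\<lambda>_. borel)) (\<lambda>\<omega>. \<lambda>i\<in>{..<n}. X i \<omega>) = PiM {..<n} (\<lambda>i. distr M borel (X i))"
    using indep_vars_iff_distr_eq_PiM'[where I="{..<n}" and M'="\<lambda>_. borel" and X=X] Xm indep n by auto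
  also have "\<dots> = PiM {..<n} (\<lambda>_. gauss h)" by (simp add: d)
  finally have 1: "distr M (PiM {..<n} (\<lambda>_. borel)) (\<lambda>\<omega>. \<lambda>i\<in>{..<n}. X i \<omega>) = PiM {..<n} (\<lambda>_. gauss h)" .
  have s: "sets (PiM {..<n} (\<lambda>_. gauss h)) = sets (PiM {..<n} (\<lambda>_. borel :: real measure))"
    by (intro sets_PiM_cong) auto
  show "distr M (PiM {..<n} (\<lambda>_. gauss h)) (\<lambda>\<omega>. \<lambda>i\<in>{..<n}. B (real (Suc i) * h) \<omega> - B (real i * h) \<omega>)
    = PiM {..<n} (\<lambda>_. gauss h)"
    unfolding 1[symmetric, unfolded X_def] by (rule distr_cong) (auto simp: 1[unfolded X_def] s)
  have "(\<lambda>\<omega>. \<lambda>i\<in>{..<n}. X i \<omega>) \<in> M \<rightarrow>\<^sub>M PiM {..<n} (\<lambda>_. borel)"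
    by (intro measurable_restrict Xm)
  then show "(\<lambda>\<omega>. \<lambda>i\<in>{..<n}. B (real (Suc i) * h) \<omega> - B (real i * h) \<omega>) \<in> M \<rightarrow>\<^sub>M PiM {..<n} (\<lambda>_. gauss h)"
    unfolding X_def using measurable_cong_sets[OF refl s] by blast
qed

lemma brownian_grid_expectation:
  fixes x c \<mu> h C :: real
  assumes BM: "std_brownian_motion M B" and h: "h > 0" and n: "n > 0" and x: "x \<ge> 0"
    and g: "g \<in> borel_measurable borel" "\<And>z. z \<ge> 0 \<Longrightarrow> \<bar>g z\<bar> \<le> C"
  defines "F \<equiv> \<lambda>\<omega>. reflected_weight c x (\<lambda>k. B (real k * h) \<omega> - \<mu> * (real k * h)) n g"
  shows "integrable M F" and "integral\<^sup>L M F = (robin_step c \<mu> h ^^ n) g x"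
proof -
  define Y where "Y = (\<lambda>\<omega>. \<lambda>i\<in>{..<n}. B (real (Suc i) * h) \<omega> - B (real i * h) \<omega>)"
  let ?P = "PiM {..<n} (\<lambda>_::nat. gauss h)"
  note Y = brownian_grid_distr[OF BM h n, folded Y_def]
  have F: "F \<omega> = reflected_weight c x (drift_walk \<mu> h (Y \<omega>)) n g" if "\<omega> \<in> space M" for \<omega>
  proof -
    have B0: "B 0 \<omega> = 0" using BM that by (simp add: std_brownian_motion_def)
    have w: "drift_walk \<mu> h (Y \<omega>) k = B (real k * h) \<omega> - \<mu> * (real k * h)" if "k \<le> n" for k
    proof -
      have "drift_walk \<mu> h (Y \<omega>) k = (\<Sum>i<k. (B (real (Suc i) * h) \<omega> - \<mu> * (real (Suc i) * h)) - (B (real i * h) \<omega> - \<mu> * (real i * h)))"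
        unfolding drift_walk_def Y_def using that by (intro sum.cong) (auto simp: algebra_simps)
      also have "\<dots> = B (real k * h) \<omega> - \<mu> * (real k * h)"
        by (subst sum_lessThan_telescope) (simp add: B0)
      finally show ?thesis .
    qed
    then have "running_max x (drift_walk \<mu> h (Y \<omega>)) n = running_max x (\<lambda>k. B (real k * h) \<omega> - \<mu> * (real k * h)) n"
      by (intro running_max_cong) auto
    then show ?thesis unfolding F_def reflected_weight_def using w by simp
  qed
  have E: "integrable ?P (\<lambda>\<xi>. reflected_weight c x (drift_walk \<mu> h \<xi>) n g)"
    "(\<integral>\<xi>. reflected_weight c x (drift_walk \<mu> h \<xi>) n g \<partial>?P) = (robin_step c \<mu> h ^^ n) g x"
    by (rule reflected_weight_expectation[where C=C]; use h x g in simp)+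
  have i: "integrable M (\<lambda>\<omega>. reflected_weight c x (drift_walk \<mu> h (Y \<omega>)) n g)"
    by (rule integrable_distr[OF Y(2)]) (simp add: Y(1) E(1))
  show "integrable M F"
    using i by (rule Bochner_Integration.integrable_cong[THEN iffD1, rotated 2]) (simp_all add: F)
  have "integral\<^sup>L M F = (\<integral>\<omega>. reflected_weight c x (drift_walk \<mu> h (Y \<omega>)) n g \<partial>M)"
    by (rule Bochner_Integration.integral_cong) (simp_all add: F)
  also have "\<dots> = (\<integral>\<xi>. reflected_weight c x (drift_walk \<mu> h \<xi>) n g \<partial>distr M ?P Y)"
    by (rule integral_distr[symmetric]) (use Y E(1) in auto)
  also have "\<dots> = (robin_step c \<mu> h ^^ n) g x" using E(2) Y(1) by simp
  finally show "integral\<^sup>L M F = (robin_step c \<mu> h ^^ n) g x" .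
qed

text \<open>The path attains its supremum at some \<open>s\<close>, and the grid maximum is squeezed
  between the value at the last grid point before \<open>s\<close> and the supremum. The bound from
  above holds for every mesh and later provides the dominating function.\<close>

lemma running_max_grid_tendsto:
  fixes p :: "real \<Rightarrow> real"
  assumes p: "continuous_on {0..t} p" and t: "t > 0" and x: "x \<ge> 0" and p0: "p 0 = 0"
  shows "(\<lambda>n. running_max x (\<lambda>k. p (real k * (t / real n))) n) \<longlonglongrightarrow> max x (SUP s\<in>{0..t}. p s)"
    and "n > 0 \<Longrightarrow> running_max x (\<lambda>k. p (real k * (t / real n))) n \<le> max x (SUP s\<in>{0..t}. p s)"
proof -
  let ?R = "\<lambda>n. running_max x (\<lambda>k. p (real k * (t / real n))) n"
  obtain s where s: "s \<in> {0..t}" "\<And>r. r \<in> {0..t} \<Longrightarrow> p r \<le> p s"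
    using continuous_attains_sup[of "{0..t}" p] p t by auto
  have sup: "(SUP s\<in>{0..t}. p s) = p s"
    by (rule cSup_eq_maximum) (use s in auto)
  have grid: "real k * (t / real n) \<in> {0..t}" if "k \<le> n" "n > 0" for k n
  proof -
    have "real k * t \<le> real n * t" using that t by (intro mult_right_mono) auto
    then show ?thesis using that t by (simp add: field_simps)
  qed
  show le: "?R n \<le> max x (SUP s\<in>{0..t}. p s)" if "n > 0" for n
    unfolding sup using s(2)[OF grid[OF _ that]] by (intro running_max_le) (auto simp: le_max_iff_disj)
  define k where "k = (\<lambda>n. nat \<lfloor>s / t * real n\<rfloor>)"
  have kle: "k n \<le> n" for n
  proof -
    have "s / t * real n \<le> 1 * real n" using s(1) t by (intro mult_right_mono) auto
    then show ?thesis unfolding k_def by (simp add: nat_le_iff floor_le_iff)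
  qed
  have "(\<lambda>n. real (k n) * (t / real n)) \<longlonglongrightarrow> s"
  proof (rule tendsto_sandwich[OF _ _ _ tendsto_const])
    have kf: "real (k n) = of_int \<lfloor>s / t * real n\<rfloor>" for n
      using s(1) t unfolding k_def by (simp add: of_nat_nat)
    have b: "s / t * real n - 1 \<le> real (k n)" "real (k n) \<le> s / t * real n" for n
      unfolding kf by linarith+
    show "\<forall>\<^sub>F n in sequentially. real (k n) * (t / real n) \<le> s"
      using eventually_gt_at_top[of 0]
    proof eventually_elim
      case (elim n)
      have "real (k n) * (t / real n) \<le> (s / t * real n) * (t / real n)" using b t by (intro mult_right_mono) auto
      then show ?case using elim t by simp
    qed
    show "\<forall>\<^sub>F n in sequentially. s - t / real n \<le> real (k n) * (t / real n)"
      using eventually_gt_at_top[of 0]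
    proof eventually_elim
      case (elim n)
      have "(s / t * real n - 1) * (t / real n) \<le> real (k n) * (t / real n)" using b t by (intro mult_right_mono) auto
      also have "(s / t * real n - 1) * (t / real n) = s - t / real n" using elim t by (simp add: field_simps)
      finally show ?case .
    qed
    have "(\<lambda>n. s - t / real n) \<longlonglongrightarrow> s - 0"
      by (intro tendsto_diff tendsto_const lim_const_over_n)
    then show "(\<lambda>n. s - t / real n) \<longlonglongrightarrow> s" by simp
  qed
  then have "(\<lambda>n. p (real (k n) * (t / real n))) \<longlonglongrightarrow> p s"
    by (rule continuous_on_tendsto_compose[OF p])
       (use s(1) grid[OF kle] in \<open>auto intro!: eventually_sequentiallyI[of 1]\<close>)
  then have lim: "(\<lambda>n. max x (p (real (k n) * (t / real n)))) \<longlonglongrightarrow> max x (p s)"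
    by (intro tendsto_max tendsto_const)
  \<comment> \<open>If the chosen grid point is 0, its value is not among those compared by
    \<open>running_max\<close>, but \<open>p 0 = 0\<close> is at most \<open>x\<close>.\<close>
  have ge: "max x (p (real (k n) * (t / real n))) \<le> ?R n" for n
  proof (cases "k n = 0")
    case True then show ?thesis using running_max_ge x by (simp add: p0)
  next
    case False
    then show ?thesis using running_max_ge[of x] running_max_ge_nth[OF kle, of n "\<lambda>k. p (real k * (t / real n))" x] by simp
  qed
  show "?R \<longlonglongrightarrow> max x (SUP s\<in>{0..t}. p s)"
  proof (rule tendsto_sandwich[OF _ _ lim[folded sup] tendsto_const])
    show "\<forall>\<^sub>F n in sequentially. ?R n \<le> max x (SUP s\<in>{0..t}. p s)"
      using eventually_gt_at_top[of 0] by eventually_elim (rule le)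
  qed (use ge in auto)
qed

subsection \<open>Passage to continuous time\<close>

context
  fixes M :: "'a measure" and B :: "real \<Rightarrow> 'a \<Rightarrow> real" and \<mu> t :: real
  assumes BM: "std_brownian_motion M B" and t: "t > 0"
begin

lemma brownian_path:
  assumes "\<omega> \<in> space M"
  shows "continuous_on {0..t} (\<lambda>s. B s \<omega> - \<mu> * s)" and "B 0 \<omega> = 0"
proof -
  have c: "continuous_on {0..} (\<lambda>s. B s \<omega>)" and "B 0 \<omega> = 0"
    using BM assms by (auto simp: std_brownian_motion_def)
  then show "B 0 \<omega> = 0" by simp
  show "continuous_on {0..t} (\<lambda>s. B s \<omega> - \<mu> * s)"
    by (intro continuous_intros continuous_on_subset[OF c]) auto
qed

lemma run_sup_nonneg:
  assumes "\<omega> \<in> space M"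
  shows "run_sup \<mu> B t \<omega> \<ge> 0"
proof -
  have "bdd_above ((\<lambda>s. B s \<omega> - \<mu> * s) ` {0..t})"
    by (intro bounded_imp_bdd_above compact_imp_bounded compact_continuous_image brownian_path assms) auto
  then have "B 0 \<omega> - \<mu> * 0 \<le> run_sup \<mu> B t \<omega>"
    unfolding run_sup_def using t by (intro cSUP_upper) auto
  then show ?thesis using brownian_path[OF assms] by simp
qed

lemma running_max_tendsto_run_sup:
  assumes "\<omega> \<in> space M" "x \<ge> 0"
  shows "(\<lambda>n. running_max x (\<lambda>k. B (real k * (t / real n)) \<omega> - \<mu> * (real k * (t / real n))) n) \<longlonglongrightarrow> max x (run_sup \<mu> B t \<omega>)"
    and "n > 0 \<Longrightarrow> running_max x (\<lambda>k. B (real k * (t / real n)) \<omega> - \<mu> * (real k * (t / real n))) n \<le> max x (run_sup \<mu> B t \<omega>)"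
  using running_max_grid_tendsto[OF brownian_path(1)[OF assms(1)] t assms(2)] brownian_path(2)[OF assms(1)]
  unfolding run_sup_def by simp_all

lemma run_sup_measurable: "run_sup \<mu> B t \<in> borel_measurable M"
proof (rule borel_measurable_LIMSEQ_real)
  fix \<omega> assume "\<omega> \<in> space M"
  then show "(\<lambda>n. running_max 0 (\<lambda>k. B (real k * (t / real n)) \<omega> - \<mu> * (real k * (t / real n))) n) \<longlonglongrightarrow> run_sup \<mu> B t \<omega>"
    using running_max_tendsto_run_sup(1)[of \<omega> 0] run_sup_nonneg by (simp add: max_absorb2)
next
  fix n
  have [measurable]: "B (real k * (t / real n)) \<in> borel_measurable M" for k
    using BM t by (simp add: std_brownian_motion_def)
  have "(\<lambda>\<omega>. running_max 0 (\<lambda>k. B (real k * (t / real n)) \<omega> - \<mu> * (real k * (t / real n))) m) \<in> borel_measurable M" for m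
  proof (induction m)
    case (Suc m)
    note [measurable] = Suc
    show ?case unfolding running_max.simps by measurable
  qed simp
  then show "(\<lambda>\<omega>. running_max 0 (\<lambda>k. B (real k * (t / real n)) \<omega> - \<mu> * (real k * (t / real n))) n) \<in> borel_measurable M" .
qed

lemma B_t_measurable: "B t \<in> borel_measurable M"
  using BM t by (simp add: std_brownian_motion_def)

lemma refl_measurable:
  "refl_bm \<mu> x B t \<in> borel_measurable M" "refl_local_time \<mu> x B t \<in> borel_measurable M"
  using run_sup_measurable B_t_measurable unfolding refl_bm_def[abs_def] refl_local_time_def[abs_def] by measurable

lemma refl_bm_nonneg:
  assumes "\<omega> \<in> space M"
  shows "refl_bm \<mu> x B t \<omega> \<ge> 0"
proof -
  have "bdd_above ((\<lambda>s. B s \<omega> - \<mu> * s) ` {0..t})"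
    by (intro bounded_imp_bdd_above compact_imp_bounded compact_continuous_image brownian_path assms) auto
  then have "B t \<omega> - \<mu> * t \<le> run_sup \<mu> B t \<omega>"
    unfolding run_sup_def using t by (intro cSUP_upper) auto
  then show ?thesis by (simp add: refl_bm_def)
qed

lemma reflected_weight_tendsto:
  assumes "\<omega> \<in> space M" "x \<ge> 0" and g: "continuous_on UNIV g"
  shows "(\<lambda>n. reflected_weight c x (\<lambda>k. B (real k * (t / real n)) \<omega> - \<mu> * (real k * (t / real n))) n g)
    \<longlonglongrightarrow> g (refl_bm \<mu> x B t \<omega>) * exp (- c * refl_local_time \<mu> x B t \<omega>)"
proof -
  let ?R = "\<lambda>n. running_max x (\<lambda>k. B (real k * (t / real n)) \<omega> - \<mu> * (real k * (t / real n))) n"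
  have R: "?R \<longlonglongrightarrow> max x (run_sup \<mu> B t \<omega>)" by (rule running_max_tendsto_run_sup) fact+
  have "(\<lambda>n. g (?R n - (B t \<omega> - \<mu> * t)) * exp (- c * (?R n - x)))
    \<longlonglongrightarrow> g (refl_bm \<mu> x B t \<omega>) * exp (- c * refl_local_time \<mu> x B t \<omega>)"
    unfolding refl_bm_def refl_local_time_def
    by (intro tendsto_intros R continuous_on_tendsto_compose[OF g]) auto
  then show ?thesis
    by (rule Lim_transform_eventually)
       (use eventually_gt_at_top[of 0] in eventually_elim, simp add: reflected_weight_def)
qed

lemma exp_local_time_integrable:
  assumes x: "x \<ge> 0"
  shows "integrable M (\<lambda>\<omega>. exp (a * refl_local_time \<mu> x B t \<omega>))"
proof (rule integrableI_bounded)
  note [measurable] = refl_measurable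
  define F where "F = (\<lambda>n \<omega>. reflected_weight (- a) x (\<lambda>k. B (real k * (t / real n)) \<omega> - \<mu> * (real k * (t / real n))) n (\<lambda>_. 1))"
  define C where "C = 2 * exp (barrier_rate (- a) \<mu> * t)"
  have F0: "F n \<omega> \<ge> 0" for n \<omega> by (simp add: F_def reflected_weight_def)
  \<comment> \<open>The index \<open>Suc n\<close> avoids \<open>n = 0\<close>, where
    \<open>t / real n\<close> is 0 by convention and there is no Gaussian step.\<close>
  have Fi: "integrable M (F (Suc n))" and Fe: "integral\<^sup>L M (F (Suc n)) \<le> C" for n
  proof -
    have h: "t / real (Suc n) > 0" using t by simp
    have E: "integrable M (F (Suc n))"
      "integral\<^sup>L M (F (Suc n)) = (robin_step (- a) \<mu> (t / real (Suc n)) ^^ Suc n) (\<lambda>_. 1) x"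
      unfolding F_def by (rule brownian_grid_expectation[OF BM h _ x, where C=1]; simp)+
    show "integrable M (F (Suc n))" by fact
    have "\<bar>(robin_step (- a) \<mu> (t / real (Suc n)) ^^ Suc n) (\<lambda>_. 1) x\<bar> \<le> 2 * 1 * exp (barrier_rate (- a) \<mu> * (Suc n * (t / real (Suc n))))"
      by (rule robin_step_funpow_bounds(2)[OF h]) (use x in auto)
    then show "integral\<^sup>L M (F (Suc n)) \<le> C" unfolding E C_def by simp
  qed
  have "(\<integral>\<^sup>+\<omega>. ennreal (norm (exp (a * refl_local_time \<mu> x B t \<omega>))) \<partial>M) = (\<integral>\<^sup>+\<omega>. liminf (\<lambda>n. ennreal (F (Suc n) \<omega>)) \<partial>M)"
  proof (rule nn_integral_cong)
    fix \<omega> assume \<omega>: "\<omega> \<in> space M"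
    have "(\<lambda>n. F n \<omega>) \<longlonglongrightarrow> 1 * exp (- (- a) * refl_local_time \<mu> x B t \<omega>)"
      unfolding F_def by (rule reflected_weight_tendsto[OF \<omega> x]) simp
    then have "(\<lambda>n. ennreal (F (Suc n) \<omega>)) \<longlonglongrightarrow> ennreal (exp (a * refl_local_time \<mu> x B t \<omega>))"
      by (intro tendsto_ennrealI LIMSEQ_Suc) simp
    then show "ennreal (norm (exp (a * refl_local_time \<mu> x B t \<omega>))) = liminf (\<lambda>n. ennreal (F (Suc n) \<omega>))"
      by (simp add: lim_imp_Liminf)
  qed
  also have "\<dots> \<le> liminf (\<lambda>n. \<integral>\<^sup>+\<omega>. ennreal (F (Suc n) \<omega>) \<partial>M)"
    using borel_measurable_integrable[OF Fi] by (intro nn_integral_liminf) measurable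
  also have "\<dots> \<le> ennreal C"
  proof (rule Liminf_le)
    have "(\<integral>\<^sup>+\<omega>. ennreal (F (Suc n) \<omega>) \<partial>M) \<le> ennreal C" for n
      by (subst nn_integral_eq_integral[OF Fi]) (use F0 Fe in \<open>auto intro!: ennreal_leI\<close>)
    then show "\<forall>\<^sub>F n in sequentially. (\<integral>\<^sup>+\<omega>. ennreal (F (Suc n) \<omega>) \<partial>M) \<le> ennreal C" by simp
  qed simp
  also have "\<dots> < \<infinity>" by simp
  finally show "(\<integral>\<^sup>+\<omega>. ennreal (norm (exp (a * refl_local_time \<mu> x B t \<omega>))) \<partial>M) < \<infinity>" .
qed (use refl_measurable in measurable)

text \<open>Dominated convergence: a grid maximum never exceeds the true supremum, so every weight
  is bounded by an exponential of the limiting local time.\<close>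

lemma robin_iterates_tendsto_expectation:
  assumes x: "x \<ge> 0" and g: "continuous_on UNIV g" "\<And>z. z \<ge> 0 \<Longrightarrow> \<bar>g z\<bar> \<le> C"
  shows "(\<lambda>n. (robin_step c \<mu> (t / real n) ^^ n) g x)
    \<longlonglongrightarrow> (\<integral>\<omega>. g (refl_bm \<mu> x B t \<omega>) * exp (- c * refl_local_time \<mu> x B t \<omega>) \<partial>M)"
proof -
  define F where "F = (\<lambda>n \<omega>. reflected_weight c x (\<lambda>k. B (real k * (t / real n)) \<omega> - \<mu> * (real k * (t / real n))) n g)"
  have C: "C \<ge> 0" using g(2)[of 0] by linarith
  have [measurable]: "g \<in> borel_measurable borel" using g(1) by (rule borel_measurable_continuous_onI)
  note [measurable] = refl_measurable
  have E: "integrable M (F (Suc n))"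
      "integral\<^sup>L M (F (Suc n)) = (robin_step c \<mu> (t / real (Suc n)) ^^ Suc n) g x" for n
    unfolding F_def by (rule brownian_grid_expectation[OF BM _ _ x, where C=C]; use t g(2) in simp)+
  have "(\<lambda>n. integral\<^sup>L M (F (Suc n))) \<longlonglongrightarrow> (\<integral>\<omega>. g (refl_bm \<mu> x B t \<omega>) * exp (- c * refl_local_time \<mu> x B t \<omega>) \<partial>M)"
  proof (rule integral_dominated_convergence)
    show "integrable M (\<lambda>\<omega>. C * exp (\<bar>c\<bar> * refl_local_time \<mu> x B t \<omega>))"
      using exp_local_time_integrable[OF x] by simp
    show "AE \<omega> in M. (\<lambda>n. F (Suc n) \<omega>) \<longlonglongrightarrow> g (refl_bm \<mu> x B t \<omega>) * exp (- c * refl_local_time \<mu> x B t \<omega>)"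
      unfolding F_def
      by (intro AE_I2 LIMSEQ_Suc[OF reflected_weight_tendsto[OF _ x g(1)]])
    show "AE \<omega> in M. norm (F (Suc n) \<omega>) \<le> C * exp (\<bar>c\<bar> * refl_local_time \<mu> x B t \<omega>)" for n
    proof (rule AE_I2)
      fix \<omega> assume \<omega>: "\<omega> \<in> space M"
      let ?s = "\<lambda>k. B (real k * (t / real (Suc n))) \<omega> - \<mu> * (real k * (t / real (Suc n)))"
      let ?R = "running_max x ?s (Suc n)"
      have "?R \<le> max x (run_sup \<mu> B t \<omega>)" by (rule running_max_tendsto_run_sup[OF \<omega> x]) simp
      then have 1: "?R - x \<le> refl_local_time \<mu> x B t \<omega>" by (simp add: refl_local_time_def)
      have 2: "x \<le> ?R" by (rule running_max_ge)
      have 3: "?s (Suc n) \<le> ?R" by (rule running_max_ge_nth) auto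
      have "- c * (?R - x) \<le> \<bar>c\<bar> * (?R - x)" using 2 by (intro mult_right_mono) auto
      also have "\<dots> \<le> \<bar>c\<bar> * refl_local_time \<mu> x B t \<omega>" using 1 by (intro mult_left_mono) auto
      finally have "exp (- c * (?R - x)) \<le> exp (\<bar>c\<bar> * refl_local_time \<mu> x B t \<omega>)" by simp
      moreover have "\<bar>g (?R - ?s (Suc n))\<bar> \<le> C" using 3 by (intro g(2)) simp
      ultimately show "norm (F (Suc n) \<omega>) \<le> C * exp (\<bar>c\<bar> * refl_local_time \<mu> x B t \<omega>)"
        unfolding F_def reflected_weight_def real_norm_def abs_mult abs_exp_cancel
        using C by (intro mult_mono) auto
    qed
  qed (use E in \<open>auto intro: borel_measurable_integrable\<close>)
  then show ?thesis unfolding E by (rule LIMSEQ_imp_Suc)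
qed

end

subsection \<open>Dependence on the starting point\<close>

text \<open>Keeping the integral instead of its closed form spares a case distinction at
  \<open>c = 0\<close>. The \<open>+ 1\<close> in the exponent of the bound absorbs the length of
  the interval through l \<le> exp l.\<close>

lemma exp_primitive:
  fixes c :: real
  defines "G \<equiv> \<lambda>l. integral {0..l} (\<lambda>s. exp (- c * s))"
  shows "0 < l \<Longrightarrow> (G has_real_derivative exp (- c * l)) (at l)"
    and "continuous_on {0..} G"
    and "0 \<le> l \<Longrightarrow> \<bar>G l\<bar> \<le> exp ((\<bar>c\<bar> + 1) * l)"
proof -
  have c: "continuous_on A (\<lambda>s. exp (- c * s))" for A by (intro continuous_intros)
  show "(G has_real_derivative exp (- c * l)) (at l)" if "0 < l"
  proof -
    have "(G has_real_derivative exp (- c * l)) (at l within {0..l+1})"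
      unfolding G_def by (rule integral_has_real_derivative[OF c]) (use that in auto)
    then show ?thesis using that at_within_interior[of l "{0..l+1}"] by simp
  qed
  show "continuous_on {0..} G"
    unfolding continuous_on_eq_continuous_within
  proof
    fix l :: real assume "l \<in> {0..}"
    then have "continuous_on {0..l+1} G"
      unfolding G_def by (intro indefinite_integral_continuous_1 integrable_continuous_real c)
    then have "continuous (at l within {0..l+1}) G"
      using \<open>l \<in> {0..}\<close> by (auto simp: continuous_on_eq_continuous_within)
    moreover have "at l within {0..} = at l within {0..l+1}"
      by (rule at_within_nhd[of l "{..<l+1}"]) auto
    ultimately show "continuous (at l within {0..}) G" by simp
  qed
  show "\<bar>G l\<bar> \<le> exp ((\<bar>c\<bar> + 1) * l)" if "0 \<le> l"
  proof -
    have "norm (G l) \<le> exp (\<bar>c\<bar> * l) * (l - 0)"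
      unfolding G_def
    proof (rule integral_bound[OF that c])
      fix s assume s: "s \<in> {0..l}"
      have "- c * s \<le> \<bar>c\<bar> * s" using s by (intro mult_right_mono) auto
      also have "\<dots> \<le> \<bar>c\<bar> * l" using s by (intro mult_left_mono) auto
      finally show "norm (exp (- c * s)) \<le> exp (\<bar>c\<bar> * l)" by simp
    qed
    also have "\<dots> \<le> exp (\<bar>c\<bar> * l) * exp l"
    proof -
      have "l \<le> exp l" using exp_ge_add_one_self[of l] by linarith
      then show ?thesis by (intro mult_left_mono) auto
    qed
    finally show ?thesis by (simp add: exp_add[symmetric] algebra_simps)
  qed
qed

text \<open>The integrand is the derivative in the starting point \<open>y\<close> of the functional on the right,
  where \<open>S\<close> is the running supremum and \<open>b\<close> the endpoint of the driving path.\<close>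

lemma reflected_path_integral:
  fixes f f' :: "real \<Rightarrow> real" and c S b x N :: real
  assumes f: "\<And>x. x \<ge> 0 \<Longrightarrow> (f has_real_derivative f' x) (at x within {0..})"
    and f': "continuous_on {0..} f'" and bS: "b \<le> S" and xN: "x \<le> N"
  defines "k \<equiv> \<lambda>y. f' (max y S - b) * exp (- c * (max y S - y))"
    and "H \<equiv> \<lambda>y. f (max y S - b) - f' (max y S - b) * integral {0..max y S - y} (\<lambda>s. exp (- c * s))"
  shows "continuous_on {x..N} k" and "(k has_integral H N - H x) {x..N}"
proof -
  define G where "G = (\<lambda>l. integral {0..l} (\<lambda>s. exp (- c * s)))"
  have X: "continuous_on A (\<lambda>y. max y S - b)" "continuous_on A (\<lambda>y. max y S - y)" for A
    by (intro continuous_intros)+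
  have fc: "continuous_on {0..} f"
    using f by (auto intro!: DERIV_continuous simp: continuous_on_eq_continuous_within)
  have cf': "continuous_on A (\<lambda>y. f' (max y S - b))" for A
    by (rule continuous_on_compose2[OF f' X(1)]) (use bS in auto)
  have cf: "continuous_on A (\<lambda>y. f (max y S - b))" for A
    by (rule continuous_on_compose2[OF fc X(1)]) (use bS in auto)
  have cG: "continuous_on A (\<lambda>y. G (max y S - y))" for A
    unfolding G_def by (rule continuous_on_compose2[OF exp_primitive(2) X(2)]) auto
  show "continuous_on {x..N} k" unfolding k_def by (intro continuous_intros cf')
  have Hc: "continuous_on {x..N} H"
    unfolding H_def using cG cf cf' unfolding G_def by (intro continuous_intros) auto
  show "(k has_integral H N - H x) {x..N}"
  \<comment> \<open>The maximum has a kink at \<open>y = S\<close>; one exceptional point is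
    harmless since \<open>H\<close> is continuous.\<close>
  proof (rule fundamental_theorem_of_calculus_interior_strong[of "{S}"])
    fix y assume y: "y \<in> {x<..<N} - {S}"
    have "(H has_real_derivative k y) (at y)"
    \<comment> \<open>Below \<open>S\<close> the position stays at \<open>S - b\<close> and only the
      local time varies with \<open>y\<close>; above \<open>S\<close> the local time is 0 and only
      the position varies.\<close>
    proof (cases "y < S")
      case True
      have "((\<lambda>y. f (S - b) - f' (S - b) * G (S - y)) has_real_derivative 0 - f' (S - b) * (exp (- c * (S - y)) * (0 - 1))) (at y)"
        unfolding G_def
        by (intro DERIV_diff DERIV_const DERIV_cmult DERIV_chain2[OF exp_primitive(1)] DERIV_ident) (use True in auto)
      then have "((\<lambda>y. f (S - b) - f' (S - b) * G (S - y)) has_real_derivative k y) (at y)"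
        using True by (simp add: k_def)
      then show ?thesis
        by (rule has_field_derivative_transform_within_open[where S="{..<S}"])
           (use True in \<open>auto simp: H_def G_def\<close>)
    next
      case False
      then have yS: "S < y" using y by auto
      then have "y - b \<in> interior {0..}" using bS by (simp add: interior_Ici[where b="0-1"])
      then have "(f has_real_derivative f' (y - b)) (at (y - b))"
        using f[of "y - b"] yS bS at_within_interior[of "y - b" "{0..}"] by simp
      then have "((\<lambda>y. f (y - b)) has_real_derivative f' (y - b) * (1 - 0)) (at y)"
        by (rule DERIV_chain2) (intro DERIV_diff DERIV_const DERIV_ident)
      then have "((\<lambda>y. f (y - b)) has_real_derivative k y) (at y)"
        using yS by (simp add: k_def)
      then show ?thesis
        by (rule has_field_derivative_transform_within_open[where S="{S<..}"])
           (use yS in \<open>auto simp: H_def\<close>)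
    qed
    then show "(H has_vector_derivative k y) (at y)"
      by (simp add: has_real_derivative_iff_has_vector_derivative)
  qed (use xN Hc in auto)
qed

section \<open>Feynman-Kac representation of the space derivative\<close>

text \<open>For data given at a time \<epsilon> > 0, two limits of the same iterates coincide: the
  comparison gives the solution, the grid gives the expectation.\<close>

lemma ux_feynman_kac:
  fixes \<mu> \<nu> :: real
    and f' :: "real \<Rightarrow> real"
    and u ut ux uxx :: "real \<times> real \<Rightarrow> real"
    and M :: "'a measure" and B :: "real \<Rightarrow> 'a \<Rightarrow> real"
  assumes u_smooth: "C_inf_on ({0<..} \<times> {0..}) u"
    and ut_def: "\<And>t x. t > 0 \<Longrightarrow> x \<ge> 0 \<Longrightarrow> ((\<lambda>s. u (s, x)) has_real_derivative ut (t, x)) (at t)"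
    and ux_def: "\<And>t x. t > 0 \<Longrightarrow> x \<ge> 0 \<Longrightarrow> ((\<lambda>y. u (t, y)) has_real_derivative ux (t, x)) (at x within {0..})"
    and uxx_def: "\<And>t x. t > 0 \<Longrightarrow> x \<ge> 0 \<Longrightarrow> ((\<lambda>y. ux (t, y)) has_real_derivative uxx (t, x)) (at x within {0..})"
    and ux_Cb: "\<And>T. T > 0 \<Longrightarrow> continuous_on ({0..T} \<times> {0..}) ux \<and> bounded (ux ` ({0..T} \<times> {0..}))"
    and pde: "\<And>t x. t > 0 \<Longrightarrow> x \<ge> 0 \<Longrightarrow> ut (t, x) = \<mu> * ux (t, x) + 1/2 * uxx (t, x)"
    and init: "\<And>x. x \<ge> 0 \<Longrightarrow> ux (0, x) = f' x"
    and bc: "\<And>t. t > 0 \<Longrightarrow> ut (t, 0) = \<nu> * ux (t, 0)"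
    and BM: "std_brownian_motion M B"
    and t: "t > 0" and x: "x \<ge> 0"
  defines "c \<equiv> 2 * (\<nu> - \<mu>)"
  shows "ux (t, x) = (\<integral>\<omega>. f' (refl_bm \<mu> x B t \<omega>) * exp (- c * refl_local_time \<mu> x B t \<omega>) \<partial>M)"
proof -
  interpret prob_space M using BM by (simp add: std_brownian_motion_def)
  let ?S = "{0<..} \<times> {0..} :: (real \<times> real) set"
  obtain gt v where gt: "C_inf_on ?S gt" and v: "C_inf_on ?S v"
    and dgt: "\<And>t x. t > 0 \<Longrightarrow> x \<ge> 0 \<Longrightarrow> ((\<lambda>s. u (s, x)) has_real_derivative gt (t, x)) (at t)"
    and dv: "\<And>t x. t > 0 \<Longrightarrow> x \<ge> 0 \<Longrightarrow> ((\<lambda>y. u (t, y)) has_real_derivative v (t, x)) (at x within {0..})"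
    by (rule C_inf_on_halfplane_derivs[OF u_smooth]) (rule that)
  obtain vt v1 where vt: "C_inf_on ?S vt" and v1: "C_inf_on ?S v1"
    and dvt: "\<And>t x. t > 0 \<Longrightarrow> x \<ge> 0 \<Longrightarrow> ((\<lambda>s. v (s, x)) has_real_derivative vt (t, x)) (at t)"
    and dv1: "\<And>t x. t > 0 \<Longrightarrow> x \<ge> 0 \<Longrightarrow> ((\<lambda>y. v (t, y)) has_real_derivative v1 (t, x)) (at x within {0..})"
    by (rule C_inf_on_halfplane_derivs[OF v]) (rule that)
  obtain v1t v2 where v1t: "C_inf_on ?S v1t" and v2: "C_inf_on ?S v2"
    and dv1t: "\<And>t x. t > 0 \<Longrightarrow> x \<ge> 0 \<Longrightarrow> ((\<lambda>s. v1 (s, x)) has_real_derivative v1t (t, x)) (at t)"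
    and dv2: "\<And>t x. t > 0 \<Longrightarrow> x \<ge> 0 \<Longrightarrow> ((\<lambda>y. v1 (t, y)) has_real_derivative v2 (t, x)) (at x within {0..})"
    by (rule C_inf_on_halfplane_derivs[OF v1]) (rule that)
  obtain v2t v3 where v2t: "C_inf_on ?S v2t" and v3: "C_inf_on ?S v3"
    and dv2t: "\<And>t x. t > 0 \<Longrightarrow> x \<ge> 0 \<Longrightarrow> ((\<lambda>s. v2 (s, x)) has_real_derivative v2t (t, x)) (at t)"
    and dv3: "\<And>t x. t > 0 \<Longrightarrow> x \<ge> 0 \<Longrightarrow> ((\<lambda>y. v2 (t, y)) has_real_derivative v3 (t, x)) (at x within {0..})"
    by (rule C_inf_on_halfplane_derivs[OF v2]) (rule that)
  obtain vtt vtx where vtt: "C_inf_on ?S vtt" and vtx: "C_inf_on ?S vtx"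
    and dvtt: "\<And>t x. t > 0 \<Longrightarrow> x \<ge> 0 \<Longrightarrow> ((\<lambda>s. vt (s, x)) has_real_derivative vtt (t, x)) (at t)"
    and dvtx: "\<And>t x. t > 0 \<Longrightarrow> x \<ge> 0 \<Longrightarrow> ((\<lambda>y. vt (t, y)) has_real_derivative vtx (t, x)) (at x within {0..})"
    by (rule C_inf_on_halfplane_derivs[OF vt]) (rule that)
  obtain gtt gtx where gtt: "C_inf_on ?S gtt" and gtx: "C_inf_on ?S gtx"
    and dgtt: "\<And>t x. t > 0 \<Longrightarrow> x \<ge> 0 \<Longrightarrow> ((\<lambda>s. gt (s, x)) has_real_derivative gtt (t, x)) (at t)"
    and dgtx: "\<And>t x. t > 0 \<Longrightarrow> x \<ge> 0 \<Longrightarrow> ((\<lambda>y. gt (t, y)) has_real_derivative gtx (t, x)) (at x within {0..})"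
    by (rule C_inf_on_halfplane_derivs[OF gt]) (rule that)
  \<comment> \<open>The derivatives in the hypotheses are identified with members of the smooth
    family, which supplies the higher ones.\<close>
  have ut: "ut (t, x) = gt (t, x)" if "t > 0" "x \<ge> 0" for t x
    using DERIV_unique[OF ut_def[OF that] dgt[OF that]] .
  have ux: "ux (t, x) = v (t, x)" if "t > 0" "x \<ge> 0" for t x
    using halfline_derivative_unique[OF that(2) ux_def[OF that] dv[OF that]] .
  have uxx: "uxx (t, x) = v1 (t, x)" if "t > 0" "x \<ge> 0" for t x
  proof (rule halfline_derivative_unique[OF that(2) uxx_def[OF that]])
    show "((\<lambda>y. ux (t, y)) has_real_derivative v1 (t, x)) (at x within {0..})"
      by (rule has_field_derivative_transform_within[OF dv1[OF that] zero_less_one]) (use that ux in auto)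
  qed
  have gt_eq: "gt (t, x) = \<mu> * v (t, x) + v1 (t, x) / 2" if "t > 0" "x \<ge> 0" for t x
    using pde[OF that] ut[OF that] ux[OF that] uxx[OF that] by simp
  \<comment> \<open>The space derivative of the equation for \<open>u\<close>; exchanging the mixed
    partials turns that of u_t into the time derivative of \<open>v\<close>.\<close>
  have vt_eq: "vt (t, x) = \<mu> * v1 (t, x) + v2 (t, x) / 2" if tx: "t > 0" "x \<ge> 0" for t x
  proof -
    have "vt (t, x) = gtx (t, x)"
      by (rule mixed_partials_halfplane[OF dgt dv dgtx dvt _ _ tx]) (use gt gtx C_inf_on_imp_continuous_on in auto)
    moreover have "((\<lambda>y. \<mu> * v (t, y) + v1 (t, y) / 2) has_real_derivative \<mu> * v1 (t, x) + v2 (t, x) / 2) (at x within {0..})"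
      by (intro DERIV_add DERIV_cmult DERIV_cdivide dv1 dv2 tx)
    then have "((\<lambda>y. gt (t, y)) has_real_derivative \<mu> * v1 (t, x) + v2 (t, x) / 2) (at x within {0..})"
      by (rule has_field_derivative_transform_within[OF _ zero_less_one]) (use tx gt_eq in auto)
    ultimately show ?thesis using halfline_derivative_unique[OF tx(2) dgtx[OF tx]] by simp
  qed
  have robin: "v1 (t, 0) = c * v (t, 0)" if "t > 0" for t
    using gt_eq[OF that, of 0] bc[OF that] ut[OF that, of 0] ux[OF that, of 0] by (simp add: c_def algebra_simps)
  obtain C where C: "\<And>s y. 0 \<le> s \<Longrightarrow> s \<le> t + 1 \<Longrightarrow> y \<ge> 0 \<Longrightarrow> \<bar>ux (s, y)\<bar> \<le> C"
  proof -
    from ux_Cb[of "t + 1"] t obtain C where "\<forall>p\<in>ux ` ({0..t+1} \<times> {0..}). norm p \<le> C"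
      unfolding bounded_iff by auto
    then show thesis by (intro that[of C]) auto
  qed
  have uxc: "continuous_on ({0..t+1} \<times> {0..}) ux" using ux_Cb[of "t + 1"] t by auto
  let ?X = "refl_bm \<mu> x B t" and ?l = "refl_local_time \<mu> x B t"
  \<comment> \<open>The restriction to \<epsilon> \<le> 1 keeps all times in the window up to
    \<open>t + 1\<close>, on which \<open>C\<close> bounds \<open>ux\<close>.\<close>
  have rep: "ux (\<epsilon> + t, x) = (\<integral>\<omega>. ux (\<epsilon>, max 0 (?X \<omega>)) * exp (- c * ?l \<omega>) \<partial>M)" if \<epsilon>: "0 < \<epsilon>" "\<epsilon> \<le> 1" for \<epsilon>
  proof -
    have "(\<lambda>n. (robin_step c \<mu> (t / n) ^^ n) (\<lambda>z. v (\<epsilon>, max 0 z)) x) \<longlonglongrightarrow> v (\<epsilon> + t, x)"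
    proof (rule robin_step_iterates_tendsto[OF _ _ _ _ _ dv1 dv2 dv3 dvt dvtt vt_eq robin _ \<epsilon>(1) t x])
      show "\<bar>v (s, y)\<bar> \<le> C" if "\<epsilon> \<le> s" "s \<le> \<epsilon> + t" "y \<ge> 0" for s y
        using C[of s y] ux[of s y] that \<epsilon> by simp
    qed (use v v1 v2 v3 vtt C_inf_on_imp_continuous_on in auto)
    moreover have "(\<lambda>n. (robin_step c \<mu> (t / n) ^^ n) (\<lambda>z. v (\<epsilon>, max 0 z)) x)
      \<longlonglongrightarrow> (\<integral>\<omega>. v (\<epsilon>, max 0 (?X \<omega>)) * exp (- c * ?l \<omega>) \<partial>M)"
    proof (rule robin_iterates_tendsto_expectation[OF BM t x])
      show "continuous_on UNIV (\<lambda>z. v (\<epsilon>, max 0 z))"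
        by (intro continuous_on_compose2[OF C_inf_on_imp_continuous_on[OF v]])
           (use \<epsilon> in \<open>auto intro!: continuous_intros\<close>)
      show "\<bar>v (\<epsilon>, max 0 z)\<bar> \<le> C" for z
        using C[of \<epsilon> "max 0 z"] ux[of \<epsilon> "max 0 z"] \<epsilon> t by simp
    qed
    ultimately have "v (\<epsilon> + t, x) = (\<integral>\<omega>. v (\<epsilon>, max 0 (?X \<omega>)) * exp (- c * ?l \<omega>) \<partial>M)"
      by (rule LIMSEQ_unique)
    then show ?thesis using ux \<epsilon> t x by simp
  qed
  define e where "e = (\<lambda>n::nat. inverse (real (Suc n)))"
  have e: "0 < e n" "e n \<le> 1" for n by (auto simp: e_def inverse_le_1_iff)
  have e': "0 \<le> e n" "e n \<le> t + 1" "0 \<le> e n + t" "e n + t \<le> t + 1" for n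
    using e[of n] t by auto
  have e0: "e \<longlonglongrightarrow> 0" unfolding e_def by (rule LIMSEQ_inverse_real_of_nat)
  have "(\<lambda>n. ux (e n + t, x)) \<longlonglongrightarrow> ux (0 + t, x)"
    by (rule continuous_on_tendsto_compose[OF uxc tendsto_Pair[OF tendsto_add[OF e0 tendsto_const] tendsto_const]])
       (use e' t x in auto)
  moreover have "(\<lambda>n. \<integral>\<omega>. ux (e n, max 0 (?X \<omega>)) * exp (- c * ?l \<omega>) \<partial>M)
     \<longlonglongrightarrow> (\<integral>\<omega>. ux (0, max 0 (?X \<omega>)) * exp (- c * ?l \<omega>) \<partial>M)"
  proof (rule integral_dominated_convergence)
    have m: "(\<lambda>z. ux (s, max 0 z)) \<in> borel_measurable borel" if "0 \<le> s" "s \<le> 1" for s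
      by (intro borel_measurable_continuous_onI continuous_on_compose2[OF uxc])
         (use that t in \<open>auto intro!: continuous_intros\<close>)
    have m2: "(\<lambda>\<omega>. ux (s, max 0 (?X \<omega>)) * exp (- c * ?l \<omega>)) \<in> borel_measurable M" if "0 \<le> s" "s \<le> 1" for s
    proof -
      have "(\<lambda>\<omega>. ux (s, max 0 (?X \<omega>))) \<in> borel_measurable M"
        using measurable_compose[OF refl_measurable(1)[OF BM t] m[OF that]] .
      then show ?thesis using refl_measurable(2)[OF BM t] by measurable
    qed
    show "(\<lambda>\<omega>. ux (0, max 0 (?X \<omega>)) * exp (- c * ?l \<omega>)) \<in> borel_measurable M" by (rule m2) auto
    show "(\<lambda>\<omega>. ux (e n, max 0 (?X \<omega>)) * exp (- c * ?l \<omega>)) \<in> borel_measurable M" for n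
      by (rule m2) (use e[of n] in auto)
    show "integrable M (\<lambda>\<omega>. C * exp (- c * ?l \<omega>))"
      using exp_local_time_integrable[OF BM t x, where a="- c"] by simp
    show "AE \<omega> in M. (\<lambda>n. ux (e n, max 0 (?X \<omega>)) * exp (- c * ?l \<omega>)) \<longlonglongrightarrow> ux (0, max 0 (?X \<omega>)) * exp (- c * ?l \<omega>)"
      by (intro AE_I2 tendsto_mult tendsto_const continuous_on_tendsto_compose[OF uxc tendsto_Pair[OF e0 tendsto_const]])
         (use e' t in auto)
    show "AE \<omega> in M. norm (ux (e n, max 0 (?X \<omega>)) * exp (- c * ?l \<omega>)) \<le> C * exp (- c * ?l \<omega>)" for n
      unfolding real_norm_def abs_mult abs_exp_cancel
      by (intro AE_I2 mult_right_mono C) (use e[of n] t in auto)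
  qed
  ultimately have "ux (0 + t, x) = (\<integral>\<omega>. ux (0, max 0 (?X \<omega>)) * exp (- c * ?l \<omega>) \<partial>M)"
    unfolding rep[OF e] by (rule LIMSEQ_unique)
  also have "\<dots> = (\<integral>\<omega>. f' (?X \<omega>) * exp (- c * ?l \<omega>) \<partial>M)"
    by (intro Bochner_Integration.integral_cong refl) (simp add: init refl_bm_nonneg[OF BM t] max_absorb2)
  finally show ?thesis by simp
qed

section \<open>Averaging the pathwise identity\<close>

text \<open>Fubini for the pathwise identity \<open>reflected_path_integral\<close>. A joint
  dominating function exists because the local time decreases in the starting point, so the one for
  \<open>x\<close> serves all of \<open>{x..N}\<close>.\<close>

lemma reflected_functional_integral:
  fixes f f' w :: "real \<Rightarrow> real" and c \<mu> t x N :: real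
  assumes BM: "std_brownian_motion M B" and t: "t > 0" and xN: "0 \<le> x" "x \<le> N"
    and f: "\<And>x. x \<ge> 0 \<Longrightarrow> (f has_real_derivative f' x) (at x within {0..})"
    and f': "continuous_on {0..} f'" and bd: "\<And>x. x \<ge> 0 \<Longrightarrow> \<bar>f x\<bar> \<le> C" "\<And>x. x \<ge> 0 \<Longrightarrow> \<bar>f' x\<bar> \<le> C"
    and w: "\<And>y. y \<in> {x..N} \<Longrightarrow> w y = (\<integral>\<omega>. f' (refl_bm \<mu> y B t \<omega>) * exp (- c * refl_local_time \<mu> y B t \<omega>) \<partial>M)"
    and wc: "continuous_on {x..N} w"
  defines "H \<equiv> \<lambda>y \<omega>. f (refl_bm \<mu> y B t \<omega>) - f' (refl_bm \<mu> y B t \<omega>) * integral {0..refl_local_time \<mu> y B t \<omega>} (\<lambda>s. exp (- c * s))"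
  shows "integral {x..N} w = (\<integral>\<omega>. H N \<omega> - H x \<omega> \<partial>M)"
proof -
  interpret prob_space M using BM by (simp add: std_brownian_motion_def)
  interpret P: pair_sigma_finite lborel M ..
  define S where "S = run_sup \<mu> B t"
  define b where "b = (\<lambda>\<omega>. B t \<omega> - \<mu> * t)"
  have [measurable]: "S \<in> borel_measurable M" "b \<in> borel_measurable M"
    using run_sup_measurable[OF BM t] B_t_measurable[OF BM t] unfolding S_def b_def by measurable
  have X: "refl_bm \<mu> y B t \<omega> = max y (S \<omega>) - b \<omega>" "refl_local_time \<mu> y B t \<omega> = max y (S \<omega>) - y" for y \<omega>
    by (simp_all add: refl_bm_def refl_local_time_def S_def b_def)
  have bS: "b \<omega> \<le> S \<omega>" if "\<omega> \<in> space M" for \<omega>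
  proof -
    \<comment> \<open>For the auxiliary starting point \<open>- \<bar>S \<omega>\<bar>\<close> the
      maximum is \<open>S \<omega>\<close> itself, and nonnegativity of the process becomes the
      claim.\<close>
    have "0 \<le> max (- \<bar>S \<omega>\<bar>) (S \<omega>) - b \<omega>" using refl_bm_nonneg[OF BM t that, where \<mu>=\<mu> and x="- \<bar>S \<omega>\<bar>"] unfolding X .
    then show ?thesis by (simp add: max_def split: if_splits)
  qed
  have C: "C \<ge> 0" using bd(1)[of 0] by linarith
  \<comment> \<open>\<open>f'\<close> is controlled only on the half line; this continuous extension
    is Borel on the whole line and agrees with it along the paths.\<close>
  define q where "q = (\<lambda>z. f' (max 0 z))"
  have [measurable]: "q \<in> borel_measurable borel"
    unfolding q_def by (intro borel_measurable_continuous_onI continuous_on_compose2[OF f']) (auto intro!: continuous_intros)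
  have qC: "\<bar>q z\<bar> \<le> C" for z unfolding q_def by (rule bd) simp
  define k where "k = (\<lambda>(y, \<omega>). indicator {x..N} y * (q (max y (S \<omega>) - b \<omega>) * exp (- c * (max y (S \<omega>) - y))))"
  have [measurable]: "k \<in> borel_measurable (lborel \<Otimes>\<^sub>M M)"
    unfolding k_def by measurable
  define E where "E = (\<lambda>\<omega>. C * exp (\<bar>c\<bar> * refl_local_time \<mu> x B t \<omega>))"
  have Ei: "integrable M E" using exp_local_time_integrable[OF BM t xN(1)] by (simp add: E_def)
  have kE: "\<bar>k (y, \<omega>)\<bar> \<le> indicator {x..N} y * E \<omega>" for y \<omega>
  proof (cases "y \<in> {x..N}")
    case True
    have "- c * (max y (S \<omega>) - y) \<le> \<bar>c\<bar> * (max y (S \<omega>) - y)" by (intro mult_right_mono) auto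
    also have "\<dots> \<le> \<bar>c\<bar> * (max x (S \<omega>) - x)" using True by (intro mult_left_mono) auto
    finally have "\<bar>q (max y (S \<omega>) - b \<omega>)\<bar> * exp (- c * (max y (S \<omega>) - y)) \<le> C * exp (\<bar>c\<bar> * (max x (S \<omega>) - x))"
      using qC C by (intro mult_mono) auto
    then show ?thesis using True by (simp add: k_def E_def X abs_mult)
  qed (simp add: k_def)
  have ki: "integrable M (\<lambda>\<omega>. k (y, \<omega>))" for y
  proof (rule Bochner_Integration.integrable_bound)
    show "integrable M (\<lambda>\<omega>. indicator {x..N} y * E \<omega>)" using Ei by simp
    show "AE \<omega> in M. norm (k (y, \<omega>)) \<le> norm (indicator {x..N} y * E \<omega>)"
      using kE by (auto intro!: AE_I2 order_trans[OF kE])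
  qed measurable
  have kint: "integrable (lborel \<Otimes>\<^sub>M M) k"
  proof (rule P.Fubini_integrable)
    have le: "(\<integral>\<omega>. norm (k (y, \<omega>)) \<partial>M) \<le> indicator {x..N} y * integral\<^sup>L M E" for y
    proof -
      have "(\<integral>\<omega>. norm (k (y, \<omega>)) \<partial>M) \<le> (\<integral>\<omega>. indicator {x..N} y * E \<omega> \<partial>M)"
        using ki Ei kE by (intro integral_mono integrable_norm) auto
      then show ?thesis by simp
    qed
    have nn: "0 \<le> (\<integral>\<omega>. norm (k (y, \<omega>)) \<partial>M)" for y by simp
    have i: "integrable lborel (\<lambda>y. indicator {x..N} y * integral\<^sup>L M E)"
      by (intro integrable_mult_left integrable_real_indicator) (use xN in auto)
    show "integrable lborel (\<lambda>y. \<integral>\<omega>. norm (k (y, \<omega>)) \<partial>M)"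
    proof (rule Bochner_Integration.integrable_bound[OF i])
      show "(\<lambda>y. \<integral>\<omega>. norm (k (y, \<omega>)) \<partial>M) \<in> borel_measurable lborel" by measurable
      show "AE y in lborel. norm (\<integral>\<omega>. norm (k (y, \<omega>)) \<partial>M) \<le> norm (indicator {x..N} y * integral\<^sup>L M E)"
      proof (rule AE_I2)
        fix y
        show "norm (\<integral>\<omega>. norm (k (y, \<omega>)) \<partial>M) \<le> norm (indicator {x..N} y * integral\<^sup>L M E)"
          unfolding real_norm_def[of "\<integral>\<omega>. norm (k (y, \<omega>)) \<partial>M"] abs_of_nonneg[OF nn]
          using le[of y] abs_ge_self by (metis order_trans real_norm_def)
      qed
    qed
  qed (use ki in auto)
  have lebesgue_int: "(\<integral>y. indicator {x..N} y * p y \<partial>lborel) = integral {x..N} p" if "continuous_on {x..N} p" for p :: "real \<Rightarrow> real"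
    using set_borel_integral_eq_integral(2)[OF borel_integrable_atLeastAtMost'[OF that]]
    by (simp add: set_lebesgue_integral_def)
  have "integral {x..N} w = (\<integral>y. indicator {x..N} y * w y \<partial>lborel)"
    by (rule lebesgue_int[OF wc, symmetric])
  also have "\<dots> = (\<integral>y. (\<integral>\<omega>. k (y, \<omega>) \<partial>M) \<partial>lborel)"
  proof (intro Bochner_Integration.integral_cong refl)
    fix y
    have "w y = (\<integral>\<omega>. q (max y (S \<omega>) - b \<omega>) * exp (- c * (max y (S \<omega>) - y)) \<partial>M)" if "y \<in> {x..N}"
      unfolding w[OF that] X
    proof (intro Bochner_Integration.integral_cong refl)
      fix \<omega> assume "\<omega> \<in> space M"
      then show "f' (max y (S \<omega>) - b \<omega>) * exp (- c * (max y (S \<omega>) - y)) = q (max y (S \<omega>) - b \<omega>) * exp (- c * (max y (S \<omega>) - y))"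
        using bS[of \<omega>] by (simp add: q_def max_def)
    qed
    then show "indicator {x..N} y * w y = (\<integral>\<omega>. k (y, \<omega>) \<partial>M)"
      by (auto simp: k_def indicator_def)
  qed
  also have "\<dots> = (\<integral>\<omega>. (\<integral>y. k (y, \<omega>) \<partial>lborel) \<partial>M)"
    using P.Fubini_integral[of "\<lambda>y \<omega>. k (y, \<omega>)"] kint by simp
  also have "\<dots> = (\<integral>\<omega>. H N \<omega> - H x \<omega> \<partial>M)"
  proof (intro Bochner_Integration.integral_cong refl)
    fix \<omega> assume \<omega>: "\<omega> \<in> space M"
    note path = reflected_path_integral[OF f f' bS[OF \<omega>] xN(2), of c]
    have "(\<integral>y. k (y, \<omega>) \<partial>lborel) = (\<integral>y. indicator {x..N} y * (f' (max y (S \<omega>) - b \<omega>) * exp (- c * (max y (S \<omega>) - y))) \<partial>lborel)"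
      using bS[OF \<omega>] by (intro Bochner_Integration.integral_cong refl) (simp add: k_def q_def max_def)
    also have "\<dots> = H N \<omega> - H x \<omega>"
      unfolding H_def X using lebesgue_int[OF path(1)] integral_unique[OF path(2)] by simp
    finally show "(\<integral>y. k (y, \<omega>) \<partial>lborel) = H N \<omega> - H x \<omega>" .
  qed
  finally show ?thesis .
qed

text \<open>The dominating function \<open>E\<close> is built from the smaller starting point
  \<open>x\<close>, so it is the same for all \<open>y \<ge> x\<close> and survives the limit of
  \<open>y\<close> to infinity.\<close>

lemma reflected_functional_integrable:
  fixes f f' :: "real \<Rightarrow> real" and c \<mu> t x y :: real
  assumes BM: "std_brownian_motion M B" and t: "t > 0" and xy: "0 \<le> x" "x \<le> y"
    and f: "continuous_on {0..} f" and f': "continuous_on {0..} f'"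
    and bd: "\<And>x. x \<ge> 0 \<Longrightarrow> \<bar>f x\<bar> \<le> C" "\<And>x. x \<ge> 0 \<Longrightarrow> \<bar>f' x\<bar> \<le> C"
  defines "E \<equiv> \<lambda>\<omega>. C * exp ((\<bar>c\<bar> + 1) * refl_local_time \<mu> x B t \<omega>)"
    and "H1 \<equiv> \<lambda>\<omega>. f (refl_bm \<mu> y B t \<omega>)"
    and "H2 \<equiv> \<lambda>\<omega>. f' (refl_bm \<mu> y B t \<omega>) * integral {0..refl_local_time \<mu> y B t \<omega>} (\<lambda>s. exp (- c * s))"
  shows "integrable M E" "integrable M H1" "integrable M H2"
    and "\<omega> \<in> space M \<Longrightarrow> \<bar>H1 \<omega> - H2 \<omega>\<bar> \<le> C + E \<omega>"
proof -
  interpret prob_space M using BM by (simp add: std_brownian_motion_def)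
  define G where "G = (\<lambda>l. integral {0..l} (\<lambda>s. exp (- c * s)))"
  have C: "C \<ge> 0" using bd(1)[of 0] by linarith
  note [measurable] = refl_measurable[OF BM t, of \<mu> y]
  show Ei: "integrable M E" unfolding E_def using exp_local_time_integrable[OF BM t xy(1)] by simp
  have X: "refl_bm \<mu> y B t \<omega> \<ge> 0" if "\<omega> \<in> space M" for \<omega>
    using refl_bm_nonneg[OF BM t that] .
  have l: "0 \<le> refl_local_time \<mu> y B t \<omega>" "refl_local_time \<mu> y B t \<omega> \<le> refl_local_time \<mu> x B t \<omega>" for \<omega>
    using xy by (auto simp: refl_local_time_def)
  have m: "(\<lambda>z. p (max 0 z)) \<in> borel_measurable borel" if "continuous_on {0..} p" for p :: "real \<Rightarrow> real"
    by (intro borel_measurable_continuous_onI continuous_on_compose2[OF that]) (auto intro!: continuous_intros)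
  have "continuous_on {0..} G" unfolding G_def by (rule exp_primitive)
  note [measurable] = m[OF f] m[OF f'] m[OF this]
  have m1: "H1 \<in> borel_measurable M"
  proof (rule measurable_cong[THEN iffD1])
    show "(\<lambda>\<omega>. f (max 0 (refl_bm \<mu> y B t \<omega>))) \<in> borel_measurable M" by measurable
  qed (simp add: H1_def X max_absorb2)
  have m2: "H2 \<in> borel_measurable M"
  proof (rule measurable_cong[THEN iffD1])
    show "(\<lambda>\<omega>. f' (max 0 (refl_bm \<mu> y B t \<omega>)) * G (max 0 (refl_local_time \<mu> y B t \<omega>))) \<in> borel_measurable M" by measurable
  qed (simp add: H2_def G_def X l max_absorb2)
  have b1: "\<bar>H1 \<omega>\<bar> \<le> C" if "\<omega> \<in> space M" for \<omega>
    unfolding H1_def using bd(1) X[OF that] by blast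
  have b2: "\<bar>H2 \<omega>\<bar> \<le> E \<omega>" if "\<omega> \<in> space M" for \<omega>
  proof -
    have "(\<bar>c\<bar> + 1) * refl_local_time \<mu> y B t \<omega> \<le> (\<bar>c\<bar> + 1) * refl_local_time \<mu> x B t \<omega>"
      using l by (intro mult_left_mono) auto
    then have "\<bar>integral {0..refl_local_time \<mu> y B t \<omega>} (\<lambda>s. exp (- c * s))\<bar> \<le> exp ((\<bar>c\<bar> + 1) * refl_local_time \<mu> x B t \<omega>)"
      using exp_primitive(3)[where c=c, OF l(1)[of \<omega>]] by (meson exp_le_cancel_iff order_trans)
    then show ?thesis
      unfolding H2_def E_def abs_mult using C by (intro mult_mono bd X that) auto
  qed
  show "integrable M H1"
    by (rule integrable_const_bound[of _ C]) (use b1 m1 in \<open>auto intro: AE_I2\<close>)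
  show "integrable M H2"
    by (rule Bochner_Integration.integrable_bound[OF Ei m2])
       (use b2 in \<open>auto intro!: AE_I2 intro: order_trans[OF _ abs_ge_self]\<close>)
  show "\<bar>H1 \<omega> - H2 \<omega>\<bar> \<le> C + E \<omega>" if "\<omega> \<in> space M"
    using b1[OF that] b2[OF that] by linarith
qed

section \<open>Integration from the starting point to infinity\<close>

theorem theorem1:
  fixes \<mu> \<nu> :: real
    and f f' :: "real \<Rightarrow> real"
    and u ut ux uxx :: "real \<times> real \<Rightarrow> real"
    and M :: "'a measure" and B :: "real \<Rightarrow> 'a \<Rightarrow> real"
  assumes f_deriv: "\<And>x. x \<ge> 0 \<Longrightarrow> (f has_real_derivative f' x) (at x within {0..})"
    and f'_cont: "continuous_on {0..} f'"
    and f_bdd: "bounded (f ` {0..})"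
    and f'_bdd: "bounded (f' ` {0..})"
    and f_lim: "(f \<longlongrightarrow> 0) at_top"
    and u_smooth: "C_inf_on ({0<..} \<times> {0..}) u"
    and ut_def: "\<And>t x. t > 0 \<Longrightarrow> x \<ge> 0 \<Longrightarrow>
                   ((\<lambda>s. u (s, x)) has_real_derivative ut (t, x)) (at t)"
    and ux_def: "\<And>t x. t \<ge> 0 \<Longrightarrow> x \<ge> 0 \<Longrightarrow>
                   ((\<lambda>y. u (t, y)) has_real_derivative ux (t, x)) (at x within {0..})"
    and uxx_def: "\<And>t x. t > 0 \<Longrightarrow> x \<ge> 0 \<Longrightarrow>
                   ((\<lambda>y. ux (t, y)) has_real_derivative uxx (t, x)) (at x within {0..})"
    and u_Cb: "\<And>T. T > 0 \<Longrightarrow> continuous_on ({0..T} \<times> {0..}) u \<and> bounded (u ` ({0..T} \<times> {0..}))"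
    and ux_Cb: "\<And>T. T > 0 \<Longrightarrow> continuous_on ({0..T} \<times> {0..}) ux \<and> bounded (ux ` ({0..T} \<times> {0..}))"
    and u_lim: "\<And>t. t > 0 \<Longrightarrow> ((\<lambda>x. u (t, x)) \<longlongrightarrow> 0) at_top"
    and pde: "\<And>t x. t > 0 \<Longrightarrow> x \<ge> 0 \<Longrightarrow> ut (t, x) = \<mu> * ux (t, x) + 1/2 * uxx (t, x)"
    and init: "\<And>x. x \<ge> 0 \<Longrightarrow> u (0, x) = f x"
    and bc: "\<And>t. t > 0 \<Longrightarrow> ut (t, 0) = \<nu> * ux (t, 0)"
    and BM: "std_brownian_motion M B"
    and t_nn: "t \<ge> 0" and x_nn: "x \<ge> 0"
  shows "u (t, x) =
     prob_space.expectation M (\<lambda>\<omega>. f (refl_bm \<mu> x B t \<omega>))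
   - prob_space.expectation M (\<lambda>\<omega>. f' (refl_bm \<mu> x B t \<omega>) *
        integral {0..refl_local_time \<mu> x B t \<omega>} (\<lambda>s. exp (- 2 * (\<nu> - \<mu>) * s)))"
proof -
  interpret prob_space M using BM by (simp add: std_brownian_motion_def)
  define c where "c = 2 * (\<nu> - \<mu>)"
  have ceq: "- 2 * (\<nu> - \<mu>) * s = - c * s" for s by (simp add: c_def)
  define H1 where "H1 = (\<lambda>y \<omega>. f (refl_bm \<mu> y B t \<omega>))"
  define H2 where "H2 = (\<lambda>y \<omega>. f' (refl_bm \<mu> y B t \<omega>) * integral {0..refl_local_time \<mu> y B t \<omega>} (\<lambda>s. exp (- c * s)))"
  have "u (t, x) = expectation (H1 x) - expectation (H2 x)"
  \<comment> \<open>At time 0 there is no grid with positive mesh; the supremum runs over one point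
    and the local time is 0.\<close>
  proof (cases "t = 0")
    case True
    have "refl_bm \<mu> x B t \<omega> = x" "refl_local_time \<mu> x B t \<omega> = 0" if "\<omega> \<in> space M" for \<omega>
      using BM that x_nn True by (auto simp: refl_bm_def refl_local_time_def run_sup_def std_brownian_motion_def)
    then have "expectation (H1 x) = (\<integral>\<omega>. f x \<partial>M)" "expectation (H2 x) = (\<integral>\<omega>. 0 \<partial>M)"
      by (intro Bochner_Integration.integral_cong refl; simp add: H1_def H2_def)+
    then show ?thesis using True init[OF x_nn] by (simp add: prob_space)
  next
    case False
    then have t: "t > 0" using t_nn by simp
    obtain C1 where C1: "\<forall>z\<in>{0..}. \<bar>f z\<bar> \<le> C1" using f_bdd unfolding bounded_iff by auto
    obtain C2 where C2: "\<forall>z\<in>{0..}. \<bar>f' z\<bar> \<le> C2" using f'_bdd unfolding bounded_iff by auto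
    define C where "C = max C1 C2"
    have bd: "\<bar>f z\<bar> \<le> C" "\<bar>f' z\<bar> \<le> C" if "z \<ge> 0" for z
      using C1 C2 that by (auto simp: C_def le_max_iff_disj)
    have fc: "continuous_on {0..} f"
      using f_deriv by (auto intro!: DERIV_continuous simp: continuous_on_eq_continuous_within)
    define E where "E = (\<lambda>\<omega>. C * exp ((\<bar>c\<bar> + 1) * refl_local_time \<mu> x B t \<omega>))"
    have HE: "integrable M E"
      unfolding E_def by (rule reflected_functional_integrable(1)[OF BM t x_nn order_refl fc f'_cont]) (use bd in auto)
    have HI: "integrable M (H1 y)" "integrable M (H2 y)" if "x \<le> y" for y
      unfolding H1_def H2_def
      by (rule reflected_functional_integrable(2,3)[OF BM t x_nn that fc f'_cont]; use bd in blast)+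
    have HB: "\<bar>H1 y \<omega> - H2 y \<omega>\<bar> \<le> C + E \<omega>" if "x \<le> y" "\<omega> \<in> space M" for y \<omega>
      unfolding E_def H1_def H2_def
      by (rule reflected_functional_integrable(4)[OF BM t x_nn that(1) fc f'_cont _ _ that(2)]) (use bd in auto)
    have ux0: "ux (0, y) = f' y" if "y \<ge> 0" for y
    proof (rule halfline_derivative_unique[OF that])
      show "((\<lambda>y. u (0, y)) has_real_derivative ux (0, y)) (at y within {0..})" by (rule ux_def) (use that in auto)
      show "((\<lambda>y. u (0, y)) has_real_derivative f' y) (at y within {0..})"
        by (rule has_field_derivative_transform_within[OF f_deriv[OF that] zero_less_one]) (use that init in auto)
    qed
    have rep: "ux (t, y) = expectation (\<lambda>\<omega>. f' (refl_bm \<mu> y B t \<omega>) * exp (- c * refl_local_time \<mu> y B t \<omega>))" if "y \<ge> 0" for y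
      unfolding c_def
      by (rule ux_feynman_kac[OF u_smooth ut_def _ uxx_def ux_Cb pde ux0 bc BM t that]) (auto intro: ux_def)
    have diff: "u (t, N) - u (t, x) = expectation (\<lambda>\<omega>. H1 N \<omega> - H2 N \<omega>) - expectation (\<lambda>\<omega>. H1 x \<omega> - H2 x \<omega>)"
      if N: "x \<le> N" for N
    proof -
      have uxc: "continuous_on {x..N} (\<lambda>y. ux (t, y))"
        by (rule continuous_on_compose2[OF ux_Cb[OF t, THEN conjunct1]]) (use x_nn t in \<open>auto intro!: continuous_intros\<close>)
      have "((\<lambda>y. ux (t, y)) has_integral u (t, N) - u (t, x)) {x..N}"
      proof (rule fundamental_theorem_of_calculus[OF N])
        fix y assume "y \<in> {x..N}"
        then have "((\<lambda>y. u (t, y)) has_real_derivative ux (t, y)) (at y within {x..N})"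
          using ux_def[of t y] t x_nn by (auto intro: DERIV_subset)
        then show "((\<lambda>y. u (t, y)) has_vector_derivative ux (t, y)) (at y within {x..N})"
          by (simp add: has_real_derivative_iff_has_vector_derivative)
      qed
      then have "u (t, N) - u (t, x) = integral {x..N} (\<lambda>y. ux (t, y))" by (simp add: integral_unique)
      also have "\<dots> = (\<integral>\<omega>. (H1 N \<omega> - H2 N \<omega>) - (H1 x \<omega> - H2 x \<omega>) \<partial>M)"
        unfolding H1_def H2_def
        by (rule reflected_functional_integral[OF BM t x_nn N f_deriv f'_cont bd _ uxc]) (use rep x_nn in auto)
      also have "\<dots> = expectation (\<lambda>\<omega>. H1 N \<omega> - H2 N \<omega>) - expectation (\<lambda>\<omega>. H1 x \<omega> - H2 x \<omega>)"
        using HI N by (intro Bochner_Integration.integral_diff Bochner_Integration.integrable_diff) auto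
      finally show ?thesis .
    qed
    \<comment> \<open>The boundary term at infinity. Once the starting point exceeds the supremum of
      the path, the local time and hence \<open>H2\<close> vanish, and \<open>H1\<close> is
      \<open>f\<close> along a sequence tending to infinity.\<close>
    have "(\<lambda>n. expectation (\<lambda>\<omega>. H1 (x + real n) \<omega> - H2 (x + real n) \<omega>)) \<longlonglongrightarrow> expectation (\<lambda>\<omega>. 0)"
    proof (rule integral_dominated_convergence)
      show "integrable M (\<lambda>\<omega>. C + E \<omega>)" using HE by simp
      show "AE \<omega> in M. norm (H1 (x + real n) \<omega> - H2 (x + real n) \<omega>) \<le> C + E \<omega>" for n
        using HB by (intro AE_I2) simp
      show "(\<lambda>\<omega>. H1 (x + real n) \<omega> - H2 (x + real n) \<omega>) \<in> borel_measurable M" for n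
        using HI by (intro borel_measurable_integrable Bochner_Integration.integrable_diff) simp_all
      show "AE \<omega> in M. (\<lambda>n. H1 (x + real n) \<omega> - H2 (x + real n) \<omega>) \<longlonglongrightarrow> 0"
      proof (rule AE_I2)
        fix \<omega>
        define S where "S = run_sup \<mu> B t \<omega>"
        define b where "b = B t \<omega> - \<mu> * t"
        have "filterlim (\<lambda>n. (x - b) + real n) at_top sequentially"
          by (intro filterlim_tendsto_add_at_top[OF tendsto_const] filterlim_real_sequentially)
        then have "(\<lambda>n. f ((x - b) + real n)) \<longlonglongrightarrow> 0" by (rule filterlim_compose[OF f_lim])
        moreover have "\<forall>\<^sub>F n in sequentially. S - x \<le> real n"
          using filterlim_real_sequentially by (simp add: filterlim_at_top)
        then have "\<forall>\<^sub>F n in sequentially. f ((x - b) + real n) = H1 (x + real n) \<omega> - H2 (x + real n) \<omega>"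
        proof eventually_elim
          case (elim n)
          then have "max (x + real n) S = x + real n" by simp
          then show ?case by (simp add: H1_def H2_def refl_bm_def refl_local_time_def S_def b_def algebra_simps)
        qed
        ultimately show "(\<lambda>n. H1 (x + real n) \<omega> - H2 (x + real n) \<omega>) \<longlonglongrightarrow> 0"
          by (rule Lim_transform_eventually)
      qed
    qed simp
    then have lim1: "(\<lambda>n. expectation (\<lambda>\<omega>. H1 (x + real n) \<omega> - H2 (x + real n) \<omega>)) \<longlonglongrightarrow> 0" by simp
    have lim2: "(\<lambda>n. u (t, x + real n)) \<longlonglongrightarrow> 0"
      by (intro filterlim_compose[OF u_lim[OF t]] filterlim_tendsto_add_at_top[OF tendsto_const] filterlim_real_sequentially)
    have "(\<lambda>n. u (t, x + real n) - expectation (\<lambda>\<omega>. H1 (x + real n) \<omega> - H2 (x + real n) \<omega>)) \<longlonglongrightarrow> 0 - 0"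
      by (intro tendsto_diff lim1 lim2)
    \<comment> \<open>By \<open>diff\<close> the difference of the two sides is independent of the
      starting point, so it equals its limit 0.\<close>
    moreover have "u (t, x + real n) - expectation (\<lambda>\<omega>. H1 (x + real n) \<omega> - H2 (x + real n) \<omega>)
        = u (t, x) - expectation (\<lambda>\<omega>. H1 x \<omega> - H2 x \<omega>)" for n
      using diff[of "x + real n"] by simp
    ultimately have "u (t, x) = expectation (\<lambda>\<omega>. H1 x \<omega> - H2 x \<omega>)"
      by (simp add: LIMSEQ_const_iff)
    then show ?thesis using HI by simp
  qed
  then show ?thesis by (simp only: H1_def H2_def ceq)
qed

end
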